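(* Let $(E,w)$ be an (LPA) weighted graph, $(E',w')$ its $\mathcal P1$-weighted graph, and $\widetilde{E'}$ the auxiliary graph of $(E',w')$. Then the weighted graph monoid $\mathcal M(E,w)$ is cancellative if and only if the following two conditions hold: (CE1) $E'$ has no cycle with an exit; (CE2) no cycle in $\widetilde{E'}$ contains a bar edge.
   Context: A directed graph is $E=(E^0,E^1,s,r)$. Paths are sequences of edges $e_1\cdots e_n$ with $r(e_i)=s(e_{i+1})$; vertices are paths of length $0$. $u\ge v$ means there is a path from $u$ to $v$; $T(u)=\{x:u\ge x\}$, $T(X)=\bigcup_{v\in X}T(v)$. A cycle based at $s(e_1)$ is a path $e_1\cdots e_n$, $n\ge1$, with $s(e_1)=r(e_n)$ and the $s(e_i)$ pairwise distinct; an exit of it is an edge $f$ with $s(f)=s(e_i)$ for some $i$ and $f\ne e_j$ for all $j$. Edges $e,f$ are in line if $e=f$, $r(e)\ge s(f)$ or $r(f)\ge s(e)$. A weighted graph $(E,w)$ is a directed graph with $w:E^1\to\{1,2,\dots\}$; standing assumption: nonempty, row-finite ($|s^{-1}(v)|<\infty$ for all $v$), connected. $E_w=\{e:w(e)>1\}$ (weighted edges), $E_{uw}=\{e:w(e)=1\}$ (unweighted edges). Condition (LPA): (LPA1) every vertex emits at most one weighted edge; (LPA2) every vertex in $T(r(E_w))$ emits at most one edge; (LPA3) if $e,f\in E_w$ are not in line then $T(r(e))\cap T(r(f))=\varnothing$; (LPA4) if $e\in E_w$ and $C$ is a cycle based at some $v\in T(r(e))$, then $e$ is an edge of $C$. An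 (LPA) weighted graph is one satisfying these. $\mathcal P1$-weighted graph $(E',w')$ of an (LPA) weighted graph $(E,w)$: with $Z=T(r(E_w))$, $(E')^0=E^0$; each edge $e$ with $s(e)\in Z$ is replaced by $w(e)$ edges $e^{(1)},\dots,e^{(w(e))}$ of weight $1$ from $r(e)$ to $s(e)$; edges $e$ with $s(e)\notin Z$ are kept with the same source, range and weight. Auxiliary graph $\widetilde G$ of a weighted graph $(G,w)$: the directed graph with vertex set $G^0$ whose edges are the unweighted edges $e\in G_{uw}$ (same source and range as in $G$) together with, for each weighted edge $g\in G_w$, a bar edge $\overline g$ with source $r(g)$ and range $s(g)$. The weighted graph monoid $\mathcal M(E,w)$ is the commutative monoid generated by $\{v,q_1^v,\dots,q_{k_v-1}^v:v\in E^0\}$ with relations $q_{i-1}^v+(w_i(v)-w_{i-1}(v))v=q_i^v+\sum_{e\in s^{-1}(v),\,w(e)=w_i(v)}r(e)$ for $v\in E^0$, $1\le i\le k_v$, where $w_1(v)<\dots<w_{k_v}(v)$ are the distinct weights of the edges in $s^{-1}(v)$ and $q_0^v=q_{k_v}^v=0$, $w_0(v)=0$. A commutative monoid is cancellative if $a+b=c+b$ implies $a=c$. *)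

theory Defs
  imports
    "Graph_Theory.Arc_Walk"
    "Graph_Theory.Digraph_Component"
    "HOL-Library.Multiset"
    "HOL-Algebra.Divisibility"
begin

section \<open>Directed graphs\<close>

text \<open>
  Source and range of an edge are \<^const>\<open>tail\<close> and \<^const>\<open>head\<close>.
\<close>

definition down_set :: "('a, 'b) pre_digraph \<Rightarrow> 'a \<Rightarrow> 'a set" where
  "down_set G u = {x. u \<rightarrow>\<^sup>*\<^bsub>G\<^esub> x}"

definition down_sets :: "('a, 'b) pre_digraph \<Rightarrow> 'a set \<Rightarrow> 'a set" where
  "down_sets G X = (\<Union>v\<in>X. down_set G v)"

definition cycle_at :: "('a, 'b) pre_digraph \<Rightarrow> 'a \<Rightarrow> 'b list \<Rightarrow> bool" where
  "cycle_at G v C \<longleftrightarrow> pre_digraph.cycle G C \<and> tail G (hd C) = v"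

text \<open>
  \<^const>\<open>pre_digraph.cycle\<close> asks for distinct ranges of the edges, which for a closed
  walk is the same as distinct sources.
\<close>

lemma (in wf_digraph) cycle_at_iff:
  "cycle_at G v C \<longleftrightarrow> awalk v C v \<and> C \<noteq> [] \<and> distinct (map (tail G) C)"
proof -
  have *: "distinct (tl (awalk_verts u C)) \<longleftrightarrow> distinct (map (tail G) C)"
    if "awalk u C u" "C \<noteq> []" for u
  proof -
    have "awalk_verts u C = map (tail G) C @ [u]"
      using that by (simp add: awalk_verts_conv awalk_conv)
    moreover from that(2) obtain e es where C: "C = e # es"
      by (cases C) auto
    moreover have "tail G e = u"
      using \<open>awalk u C u\<close> C by (simp add: awalk_Cons_iff)
    ultimately show ?thesis
      by auto
  qed
  have "tail G (hd C) = u" if "awalk u C u" "C \<noteq> []" for u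
    using that by (cases C) (simp_all add: awalk_Cons_iff)
  with * show ?thesis
    unfolding cycle_at_def cycle_def by metis
qed

definition is_exit :: "('a, 'b) pre_digraph \<Rightarrow> 'b list \<Rightarrow> 'b \<Rightarrow> bool" where
  "is_exit G C f \<longleftrightarrow> f \<in> arcs G \<and> tail G f \<in> tail G ` set C \<and> f \<notin> set C"

definition in_line :: "('a, 'b) pre_digraph \<Rightarrow> 'b \<Rightarrow> 'b \<Rightarrow> bool" where
  "in_line G e f \<longleftrightarrow> e = f \<or> head G e \<rightarrow>\<^sup>*\<^bsub>G\<^esub> tail G f \<or> head G f \<rightarrow>\<^sup>*\<^bsub>G\<^esub> tail G e"

section \<open>Weighted graphs\<close>

definition weighted_arcs :: "('a, 'b) pre_digraph \<Rightarrow> ('b \<Rightarrow> nat) \<Rightarrow> 'b set" where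
  "weighted_arcs G w = {e \<in> arcs G. w e > 1}"

definition unweighted_arcs :: "('a, 'b) pre_digraph \<Rightarrow> ('b \<Rightarrow> nat) \<Rightarrow> 'b set" where
  "unweighted_arcs G w = {e \<in> arcs G. w e = 1}"

text \<open>
  The predicate \<^const>\<open>connected\<close> refers to the underlying undirected graph and includes
  nonemptiness of the vertex set.
\<close>

locale weighted_graph = wf_digraph G for G :: "('a, 'b) pre_digraph" +
  fixes w :: "'b \<Rightarrow> nat"
  assumes weight_pos: "e \<in> arcs G \<Longrightarrow> w e \<ge> 1"
    and nonempty: "verts G \<noteq> {}"
    and row_finite: "v \<in> verts G \<Longrightarrow> finite (out_arcs G v)"
    and connected: "connected G"

text \<open>The set $Z = T(r(E_w))$.\<close>

definition weighted_down :: "('a, 'b) pre_digraph \<Rightarrow> ('b \<Rightarrow> nat) \<Rightarrow> 'a set" where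
  "weighted_down G w = down_sets G (head G ` weighted_arcs G w)"

locale lpa_weighted_graph = weighted_graph +
  assumes LPA1: "v \<in> verts G \<Longrightarrow> e \<in> out_arcs G v \<Longrightarrow> f \<in> out_arcs G v \<Longrightarrow>
      e \<in> weighted_arcs G w \<Longrightarrow> f \<in> weighted_arcs G w \<Longrightarrow> e = f"
    and LPA2: "v \<in> weighted_down G w \<Longrightarrow> e \<in> out_arcs G v \<Longrightarrow> f \<in> out_arcs G v \<Longrightarrow> e = f"
    and LPA3: "e \<in> weighted_arcs G w \<Longrightarrow> f \<in> weighted_arcs G w \<Longrightarrow> \<not> in_line G e f \<Longrightarrow>
      down_set G (head G e) \<inter> down_set G (head G f) = {}"
    and LPA4: "e \<in> weighted_arcs G w \<Longrightarrow> v \<in> down_set G (head G e) \<Longrightarrow> cycle_at G v C \<Longrightarrow>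
      e \<in> set C"

text \<open>
  In the P1-weighted graph, \<open>Split e i\<close> is the reversed edge $e^{(i)}$, with
  $1 \le i \le w(e)$, and \<open>Keep e\<close> is an edge that is left unchanged.
\<close>

datatype 'b p1_edge = Split 'b nat | Keep 'b

fun p1_tail :: "('a, 'b) pre_digraph \<Rightarrow> 'b p1_edge \<Rightarrow> 'a" where
  "p1_tail G (Split e i) = head G e"
| "p1_tail G (Keep e) = tail G e"

fun p1_head :: "('a, 'b) pre_digraph \<Rightarrow> 'b p1_edge \<Rightarrow> 'a" where
  "p1_head G (Split e i) = tail G e"
| "p1_head G (Keep e) = head G e"

definition p1_graph :: "('a, 'b) pre_digraph \<Rightarrow> ('b \<Rightarrow> nat) \<Rightarrow> ('a, 'b p1_edge) pre_digraph" where
  "p1_graph G w = \<lparr>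
     verts = verts G,
     arcs = {Split e i | e i. e \<in> arcs G \<and> tail G e \<in> weighted_down G w \<and> 1 \<le> i \<and> i \<le> w e}
          \<union> {Keep e | e. e \<in> arcs G \<and> tail G e \<notin> weighted_down G w},
     tail = p1_tail G,
     head = p1_head G \<rparr>"

fun p1_weight :: "('b \<Rightarrow> nat) \<Rightarrow> 'b p1_edge \<Rightarrow> nat" where
  "p1_weight w (Split e i) = 1"
| "p1_weight w (Keep e) = w e"

datatype 'b aux_edge = Plain 'b | Bar 'b

fun aux_tail :: "('a, 'b) pre_digraph \<Rightarrow> 'b aux_edge \<Rightarrow> 'a" where
  "aux_tail G (Plain e) = tail G e"
| "aux_tail G (Bar g) = head G g"

fun aux_head :: "('a, 'b) pre_digraph \<Rightarrow> 'b aux_edge \<Rightarrow> 'a" where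
  "aux_head G (Plain e) = head G e"
| "aux_head G (Bar g) = tail G g"

definition aux_graph :: "('a, 'b) pre_digraph \<Rightarrow> ('b \<Rightarrow> nat) \<Rightarrow> ('a, 'b aux_edge) pre_digraph" where
  "aux_graph G w = \<lparr>
     verts = verts G,
     arcs = Plain ` unweighted_arcs G w \<union> Bar ` weighted_arcs G w,
     tail = aux_tail G,
     head = aux_head G \<rparr>"

section \<open>Commutative monoids given by generators and relations\<close>

text \<open>
  The free commutative monoid on \<open>X\<close> consists of the finite multisets over \<open>X\<close>; the
  relations \<open>R\<close> are pairs of such multisets.
\<close>

definition free_cm :: "'g set \<Rightarrow> 'g multiset set" where
  "free_cm X = {m. set_mset m \<subseteq> X}"

inductive pres_cong :: "'g set \<Rightarrow> ('g multiset \<times> 'g multiset) set \<Rightarrow> 'g multiset \<Rightarrow> 'g multiset \<Rightarrow> bool"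
  for X R where
  rel: "(a, b) \<in> R \<Longrightarrow> pres_cong X R a b"
| refl: "a \<in> free_cm X \<Longrightarrow> pres_cong X R a a"
| sym: "pres_cong X R a b \<Longrightarrow> pres_cong X R b a"
| trans: "pres_cong X R a b \<Longrightarrow> pres_cong X R b c \<Longrightarrow> pres_cong X R a c"
| add: "pres_cong X R a b \<Longrightarrow> c \<in> free_cm X \<Longrightarrow> pres_cong X R (a + c) (b + c)"

definition pres_class :: "'g set \<Rightarrow> ('g multiset \<times> 'g multiset) set \<Rightarrow> 'g multiset \<Rightarrow> 'g multiset set" where
  "pres_class X R a = {b. pres_cong X R a b}"

definition pres_monoid :: "'g set \<Rightarrow> ('g multiset \<times> 'g multiset) set \<Rightarrow> 'g multiset set monoid" where
  "pres_monoid X R = \<lparr>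
     carrier = pres_class X R ` free_cm X,
     mult = (\<lambda>A B. \<Union>a\<in>A. \<Union>b\<in>B. pres_class X R (a + b)),
     one = pres_class X R {#} \<rparr>"

lemma pres_class_eq_iff:
  assumes "b \<in> free_cm X"
  shows "pres_class X R a = pres_class X R b \<longleftrightarrow> pres_cong X R a b"
proof
  assume "pres_class X R a = pres_class X R b"
  moreover have "b \<in> pres_class X R b"
    using assms by (simp add: pres_class_def pres_cong.refl)
  ultimately have "b \<in> pres_class X R a"
    by (simp only:)
  then show "pres_cong X R a b"
    by (simp add: pres_class_def)
next
  assume ab: "pres_cong X R a b"
  have "pres_cong X R a c \<longleftrightarrow> pres_cong X R b c" for c
    using pres_cong.trans[OF ab] pres_cong.trans[OF pres_cong.sym[OF ab]] by blast
  then show "pres_class X R a = pres_class X R b"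
    by (simp add: pres_class_def)
qed

lemma pres_monoid_mult:
  assumes "a \<in> free_cm X" "b \<in> free_cm X" "R \<subseteq> free_cm X \<times> free_cm X"
  shows "pres_class X R a \<otimes>\<^bsub>pres_monoid X R\<^esub> pres_class X R b = pres_class X R (a + b)"
proof -
  have free: "x \<in> free_cm X \<and> y \<in> free_cm X" if "pres_cong X R x y" for x y
    using that assms(3) by (induction rule: pres_cong.induct) (auto simp: free_cm_def)
  have "pres_class X R (a' + b') = pres_class X R (a + b)"
    if "pres_cong X R a a'" "pres_cong X R b b'" for a' b'
  proof -
    have "pres_cong X R (a' + b') (a + b')"
      using pres_cong.add[OF pres_cong.sym[OF that(1)]] free[OF that(2)] by blast
    moreover have "pres_cong X R (b' + a) (b + a)"
      using pres_cong.add[OF pres_cong.sym[OF that(2)]] assms(1) by blast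
    ultimately have "pres_cong X R (a' + b') (a + b)"
      by (metis add.commute pres_cong.trans)
    then show ?thesis
      using assms by (subst pres_class_eq_iff) (auto simp: free_cm_def)
  qed
  then have "(\<Union>a'\<in>pres_class X R a. \<Union>b'\<in>pres_class X R b. pres_class X R (a' + b'))
      = (\<Union>a'\<in>pres_class X R a. \<Union>b'\<in>pres_class X R b. pres_class X R (a + b))"
    by (intro SUP_cong HOL.refl) (simp add: pres_class_def)
  also have "\<dots> = pres_class X R (a + b)"
  proof -
    have "a \<in> pres_class X R a" "b \<in> pres_class X R b"
      using assms by (simp_all add: pres_class_def pres_cong.refl)
    then show ?thesis by blast
  qed
  finally show ?thesis
    by (simp add: pres_monoid_def)
qed

lemma comm_monoid_pres_monoid:
  assumes "R \<subseteq> free_cm X \<times> free_cm X"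
  shows "comm_monoid (pres_monoid X R)"
proof (rule comm_monoidI)
  note m = pres_monoid_mult[OF _ _ assms]
  have car: "carrier (pres_monoid X R) = pres_class X R ` free_cm X"
    and one: "\<one>\<^bsub>pres_monoid X R\<^esub> = pres_class X R {#}"
    by (simp_all add: pres_monoid_def)
  have free: "{#} \<in> free_cm X" "a \<in> free_cm X \<Longrightarrow> b \<in> free_cm X \<Longrightarrow> a + b \<in> free_cm X" for a b
    by (auto simp: free_cm_def)
  fix x y z
  show "\<one>\<^bsub>pres_monoid X R\<^esub> \<in> carrier (pres_monoid X R)"
    using free by (simp add: car one)
  assume x: "x \<in> carrier (pres_monoid X R)"
  then show "\<one>\<^bsub>pres_monoid X R\<^esub> \<otimes>\<^bsub>pres_monoid X R\<^esub> x = x"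
    using free by (auto simp: car one m)
  assume y: "y \<in> carrier (pres_monoid X R)"
  show "x \<otimes>\<^bsub>pres_monoid X R\<^esub> y \<in> carrier (pres_monoid X R)"
    using x y free by (auto simp: car m)
  show "x \<otimes>\<^bsub>pres_monoid X R\<^esub> y = y \<otimes>\<^bsub>pres_monoid X R\<^esub> x"
    using x y by (auto simp: car m add.commute)
  assume "z \<in> carrier (pres_monoid X R)"
  then show "x \<otimes>\<^bsub>pres_monoid X R\<^esub> y \<otimes>\<^bsub>pres_monoid X R\<^esub> z
      = x \<otimes>\<^bsub>pres_monoid X R\<^esub> (y \<otimes>\<^bsub>pres_monoid X R\<^esub> z)"
    using x y free by (auto simp: car m add.assoc)
qed

section \<open>The weighted graph monoid\<close>

text \<open>\<open>num_weights G w v\<close> is $k_v$ and \<open>weight_at G w v i\<close> is $w_i(v)$.\<close>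

definition num_weights :: "('a, 'b) pre_digraph \<Rightarrow> ('b \<Rightarrow> nat) \<Rightarrow> 'a \<Rightarrow> nat" where
  "num_weights G w v = card (w ` out_arcs G v)"

definition weight_at :: "('a, 'b) pre_digraph \<Rightarrow> ('b \<Rightarrow> nat) \<Rightarrow> 'a \<Rightarrow> nat \<Rightarrow> nat" where
  "weight_at G w v i = (if i = 0 then 0 else sorted_list_of_set (w ` out_arcs G v) ! (i - 1))"

datatype 'a wgm_gen = V 'a | Q 'a nat

definition wgm_gens :: "('a, 'b) pre_digraph \<Rightarrow> ('b \<Rightarrow> nat) \<Rightarrow> 'a wgm_gen set" where
  "wgm_gens G w = V ` verts G \<union> {Q v i | v i. v \<in> verts G \<and> 1 \<le> i \<and> i < num_weights G w v}"

text \<open>The element $q_i^v$, with the convention $q_0^v = q_{k_v}^v = 0$.\<close>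

definition wgm_q :: "('a, 'b) pre_digraph \<Rightarrow> ('b \<Rightarrow> nat) \<Rightarrow> 'a \<Rightarrow> nat \<Rightarrow> 'a wgm_gen multiset" where
  "wgm_q G w v i = (if i = 0 \<or> i = num_weights G w v then {#} else {#Q v i#})"

definition wgm_lhs :: "('a, 'b) pre_digraph \<Rightarrow> ('b \<Rightarrow> nat) \<Rightarrow> 'a \<Rightarrow> nat \<Rightarrow> 'a wgm_gen multiset" where
  "wgm_lhs G w v i =
     wgm_q G w v (i - 1) + replicate_mset (weight_at G w v i - weight_at G w v (i - 1)) (V v)"

definition wgm_rhs :: "('a, 'b) pre_digraph \<Rightarrow> ('b \<Rightarrow> nat) \<Rightarrow> 'a \<Rightarrow> nat \<Rightarrow> 'a wgm_gen multiset" where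
  "wgm_rhs G w v i =
     wgm_q G w v i + (\<Sum>e\<in>{e \<in> out_arcs G v. w e = weight_at G w v i}. {#V (head G e)#})"

definition wgm_rels ::
  "('a, 'b) pre_digraph \<Rightarrow> ('b \<Rightarrow> nat) \<Rightarrow> ('a wgm_gen multiset \<times> 'a wgm_gen multiset) set" where
  "wgm_rels G w =
     {(wgm_lhs G w v i, wgm_rhs G w v i) | v i. v \<in> verts G \<and> 1 \<le> i \<and> i \<le> num_weights G w v}"

definition weighted_graph_monoid ::
  "('a, 'b) pre_digraph \<Rightarrow> ('b \<Rightarrow> nat) \<Rightarrow> 'a wgm_gen multiset set monoid" where
  "weighted_graph_monoid G w = pres_monoid (wgm_gens G w) (wgm_rels G w)"

text \<open>
  Since the weighted graph monoid is a commutative monoid, \<^const>\<open>comm_monoid_cancel\<close>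
  expresses exactly that it is cancellative.
\<close>

lemma (in weighted_graph) comm_monoid_weighted_graph_monoid:
  "comm_monoid (weighted_graph_monoid G w)"
  unfolding weighted_graph_monoid_def
proof (rule comm_monoid_pres_monoid)
  have q: "wgm_q G w v i \<in> free_cm (wgm_gens G w)"
    if "v \<in> verts G" "i \<le> num_weights G w v" for v i
    using that by (auto simp: wgm_q_def free_cm_def wgm_gens_def)
  have "wgm_lhs G w v i \<in> free_cm (wgm_gens G w) \<and> wgm_rhs G w v i \<in> free_cm (wgm_gens G w)"
    if v: "v \<in> verts G" and i: "i \<le> num_weights G w v" for v i
  proof
    show "wgm_lhs G w v i \<in> free_cm (wgm_gens G w)"
      using q[OF v, of "i - 1"] v i
      by (auto simp: wgm_lhs_def free_cm_def wgm_gens_def split: if_splits)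
    have "finite {e \<in> out_arcs G v. w e = weight_at G w v i}"
      by (rule finite_subset[OF _ row_finite[OF v]]) auto
    then have "set_mset (\<Sum>e\<in>{e \<in> out_arcs G v. w e = weight_at G w v i}. {#V (head G e)#})
        \<subseteq> V ` verts G"
      by (auto simp: set_mset_sum)
    then show "wgm_rhs G w v i \<in> free_cm (wgm_gens G w)"
      using q[OF v i] by (auto simp: wgm_rhs_def free_cm_def wgm_gens_def)
  qed
  then show "wgm_rels G w \<subseteq> free_cm (wgm_gens G w) \<times> free_cm (wgm_gens G w)"
    by (auto simp: wgm_rels_def)
qed

lemma (in weighted_graph) comm_monoid_cancel_weighted_graph_monoid_iff:
  defines "M \<equiv> weighted_graph_monoid G w"
  shows "comm_monoid_cancel M \<longleftrightarrow>
    (\<forall>a\<in>carrier M. \<forall>b\<in>carrier M. \<forall>c\<in>carrier M. a \<otimes>\<^bsub>M\<^esub> b = c \<otimes>\<^bsub>M\<^esub> b \<longrightarrow> a = c)"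
proof -
  interpret comm_monoid M
    unfolding M_def by (rule comm_monoid_weighted_graph_monoid)
  show ?thesis
  proof
    assume "comm_monoid_cancel M"
    then interpret comm_monoid_cancel M .
    show "\<forall>a\<in>carrier M. \<forall>b\<in>carrier M. \<forall>c\<in>carrier M. a \<otimes>\<^bsub>M\<^esub> b = c \<otimes>\<^bsub>M\<^esub> b \<longrightarrow> a = c"
      using r_cancel by blast
  next
    assume "\<forall>a\<in>carrier M. \<forall>b\<in>carrier M. \<forall>c\<in>carrier M. a \<otimes>\<^bsub>M\<^esub> b = c \<otimes>\<^bsub>M\<^esub> b \<longrightarrow> a = c"
    then show "comm_monoid_cancel M"
      by unfold_locales (metis m_comm)+
  qed
qed

section \<open>The conditions characterising cancellativity\<close>

definition CE1 :: "('a, 'b) pre_digraph \<Rightarrow> ('b \<Rightarrow> nat) \<Rightarrow> bool" where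
  "CE1 G w \<longleftrightarrow> \<not> (\<exists>C f. pre_digraph.cycle (p1_graph G w) C \<and> is_exit (p1_graph G w) C f)"

definition CE2 :: "('a, 'b) pre_digraph \<Rightarrow> ('b \<Rightarrow> nat) \<Rightarrow> bool" where
  "CE2 G w \<longleftrightarrow> \<not> (\<exists>C g. pre_digraph.cycle (aux_graph (p1_graph G w) (p1_weight w)) C \<and> Bar g \<in> set C)"

end

theory Submission
  imports Defs
begin

text \<open>
  The proof presents $M(E,w)$ by rules \<open>u \<rightarrow> m\<close>, each replacing a generator by a nonempty multiset of
  generators, with at most one rule per generator, and reads off cancellativity from the
  rewriting graph, in which $u$ has an edge to every generator occurring in $m$.

  Write $Z = T(r(E_w))$.  A vertex outside $Z$ that emits unweighted edges $e_1,\dots,e_n$ has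
  the rule \<open>v \<rightarrow> q + r(e\<^sub>1) + \<dots> + r(e\<^sub>n)\<close>, where $q = q_1^v$ occurs only if $v$ emits a weighted
  edge as well.  The remaining relations are read from right to left: the relation for the only
  edge $e$ at a vertex of $Z$, or for a weighted edge $e$, becomes \<open>r(e) \<rightarrow> w(e) s(e)\<close>, or
  \<open>r(e) \<rightarrow> q + (w(e) - 1) s(e)\<close> if $s(e)$ also emits unweighted edges.  No generator
  gets two rules: the range of an edge read from right to left lies in $Z$, and (LPA) implies that
  two such edges never have the same range (\<open>inj_on_head_returned_arcs\<close>).

  For presentations of this kind, \<open>cancellative_iff_rigid\<close> shows that the monoid is cancellative
  if and only if every generator on a closed walk of the rewriting graph has a rule with a single
  generator on the right; for row-finite graphs this is the criterion that no cycle has an exit.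
  If $u$ lies on a closed walk and its rule has more than one generator on the right, then
  $u = u + x$ with $x \<noteq> 0$, while only the empty multiset represents $0$.  Conversely, an equality
  $a + b = c + b$ uses only finitely many rules.  Eliminating these one generator at a time gives
  a substitution $\<phi>$ that makes the equality hold in the free monoid, where $\<phi>(b)$ cancels; and
  $\<phi>$ does not change the class of an element.

  Finally, between vertices the rewriting graph has the same adjacencies as the auxiliary graph of
  $E'$ (\<open>rule_edges_V_iff\<close>), and the generators $q_1^v$ are sinks.  A rule with several generators on
  the right, at a vertex $x$ on a cycle of the auxiliary graph, means that this cycle contains a
  bar edge, which (CE2) excludes, or is a cycle of $E'$ with an exit at $x$, which (CE1) excludes.
  In turn, an exit of a cycle of $E'$ and a bar edge on a cycle both give such a rule.
\<close>

section \<open>Presentations with one rule per generator\<close>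

definition rule_rels :: "('g \<times> 'g multiset) set \<Rightarrow> ('g multiset \<times> 'g multiset) set" where
  "rule_rels P = {({#u#}, m) | u m. (u, m) \<in> P}"

definition rule_edges :: "('g \<times> 'g multiset) set \<Rightarrow> ('g \<times> 'g) set" where
  "rule_edges P = {(u, x). \<exists>m. (u, m) \<in> P \<and> x \<in># m}"

definition mset_subst :: "('g \<Rightarrow> 'g multiset) \<Rightarrow> 'g multiset \<Rightarrow> 'g multiset" where
  "mset_subst \<phi> m = (\<Sum>x\<in>#m. \<phi> x)"

lemma mset_subst_simps [simp]:
  "mset_subst \<phi> {#} = {#}"
  "mset_subst \<phi> (add_mset x m) = \<phi> x + mset_subst \<phi> m"
  "mset_subst \<phi> (a + b) = mset_subst \<phi> a + mset_subst \<phi> b"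
  by (simp_all add: mset_subst_def)

lemma set_mset_subst [simp]: "set_mset (mset_subst \<phi> m) = (\<Union>x\<in>set_mset m. set_mset (\<phi> x))"
  by (induction m) auto

lemma mset_subst_mset_subst:
  "mset_subst \<psi> (mset_subst \<phi> m) = mset_subst (\<lambda>x. mset_subst \<psi> (\<phi> x)) m"
  by (induction m) auto

lemma mset_subst_id:
  "(\<And>x. x \<in># m \<Longrightarrow> \<phi> x = {#x#}) \<Longrightarrow> mset_subst \<phi> m = m"
  by (induction m) auto

lemma free_cm_simps [simp]:
  "{#} \<in> free_cm X"
  "add_mset x a \<in> free_cm X \<longleftrightarrow> x \<in> X \<and> a \<in> free_cm X"
  "a + b \<in> free_cm X \<longleftrightarrow> a \<in> free_cm X \<and> b \<in> free_cm X"
  by (auto simp: free_cm_def)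

lemma pres_cong_add_cong:
  assumes "pres_cong X R a a'" "pres_cong X R b b'" "a' \<in> free_cm X" "b \<in> free_cm X"
  shows "pres_cong X R (a + b) (a' + b')"
proof -
  have "pres_cong X R (b + a') (b' + a')"
    by (rule pres_cong.add[OF assms(2,3)])
  then show ?thesis
    using pres_cong.trans[OF pres_cong.add[OF assms(1,4)]] by (simp only: add.commute)
qed

lemma comm_monoid_cancel_pres_monoid_iff:
  assumes R: "R \<subseteq> free_cm X \<times> free_cm X"
  shows "comm_monoid_cancel (pres_monoid X R) \<longleftrightarrow>
    (\<forall>a\<in>free_cm X. \<forall>b\<in>free_cm X. \<forall>c\<in>free_cm X.
       pres_cong X R (a + b) (c + b) \<longrightarrow> pres_cong X R a c)" (is "?L \<longleftrightarrow> ?R")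
proof -
  let ?M = "pres_monoid X R"
  interpret comm_monoid ?M
    by (rule comm_monoid_pres_monoid[OF R])
  have car: "carrier ?M = pres_class X R ` free_cm X"
    by (simp add: pres_monoid_def)
  note m = pres_monoid_mult[OF _ _ R]
  show ?thesis
  proof
    assume ?L
    then interpret comm_monoid_cancel ?M .
    show ?R
    proof (intro ballI impI)
      fix a b c
      assume abc: "a \<in> free_cm X" "b \<in> free_cm X" "c \<in> free_cm X"
        and "pres_cong X R (a + b) (c + b)"
      then have "pres_class X R a \<otimes>\<^bsub>?M\<^esub> pres_class X R b
          = pres_class X R c \<otimes>\<^bsub>?M\<^esub> pres_class X R b"
        by (simp add: m pres_class_eq_iff)
      then have "pres_class X R a = pres_class X R c"
        by (rule r_cancel) (use abc in \<open>simp_all add: car\<close>)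
      then show "pres_cong X R a c"
        using abc by (simp add: pres_class_eq_iff)
    qed
  next
    assume cancel: ?R
    have rc: "x = z"
      if eq: "x \<otimes>\<^bsub>?M\<^esub> y = z \<otimes>\<^bsub>?M\<^esub> y" and "x \<in> carrier ?M" "y \<in> carrier ?M" "z \<in> carrier ?M"
      for x y z
    proof -
      from that(2-) obtain a b c where abc: "a \<in> free_cm X" "b \<in> free_cm X" "c \<in> free_cm X"
        and xyz: "x = pres_class X R a" "y = pres_class X R b" "z = pres_class X R c"
        unfolding car by blast
      have "pres_cong X R (a + b) (c + b)"
        using eq abc by (simp add: xyz m pres_class_eq_iff)
      then have "pres_cong X R a c"
        using cancel abc by blast
      then show "x = z"
        using abc by (simp add: xyz pres_class_eq_iff)
    qed
    show ?L
    proof unfold_locales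
      fix a b c
      assume car: "a \<in> carrier ?M" "b \<in> carrier ?M" "c \<in> carrier ?M"
      show "a = c" if "b \<otimes>\<^bsub>?M\<^esub> a = b \<otimes>\<^bsub>?M\<^esub> c"
        using that m_comm[OF car(2,1)] m_comm[OF car(2,3)] car by (intro rc[of a b c]) simp_all
    qed (rule rc)
  qed
qed

locale rule_presentation =
  fixes X :: "'g set" and P :: "('g \<times> 'g multiset) set"
  assumes single_valued: "single_valued P"
    and rule_closed: "(u, m) \<in> P \<Longrightarrow> u \<in> X" "(u, m) \<in> P \<Longrightarrow> m \<in> free_cm X"
    and rule_nonempty: "(u, m) \<in> P \<Longrightarrow> m \<noteq> {#}"
begin

abbreviation equivalent (infix \<open>\<approx>\<close> 50) where
  "a \<approx> b \<equiv> pres_cong X (rule_rels P) a b"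

text \<open>
  In the rewriting graph, a generator with a one-element right-hand side emits exactly one edge,
  so this says that closed walks have no exits, counting edges with multiplicity.
\<close>

definition rigid :: bool where
  "rigid \<longleftrightarrow> (\<forall>(u, m)\<in>P. (u, u) \<in> (rule_edges P)\<^sup>+ \<longrightarrow> size m = 1)"

lemma rigidD: "rigid \<Longrightarrow> (u, m) \<in> P \<Longrightarrow> (u, u) \<in> (rule_edges P)\<^sup>+ \<Longrightarrow> size m = 1"
  by (auto simp: rigid_def)

lemma rule_rels_free: "rule_rels P \<subseteq> free_cm X \<times> free_cm X"
  using rule_closed by (auto simp: rule_rels_def)

lemma rule_unique: "(u, m) \<in> P \<Longrightarrow> (u, m') \<in> P \<Longrightarrow> m' = m"
  using single_valued by (rule single_valuedD)

lemma rule_equivalent: "(u, m) \<in> P \<Longrightarrow> {#u#} \<approx> m"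
  by (rule pres_cong.rel) (auto simp: rule_rels_def)

text \<open>
  The monoid is conical in a strong sense: both sides of every relation are nonempty, so nothing
  but the empty multiset represents the neutral element.
\<close>

lemma equivalent_empty_iff: "a \<approx> b \<Longrightarrow> a = {#} \<longleftrightarrow> b = {#}"
  by (induction rule: pres_cong.induct) (use rule_nonempty in \<open>auto simp: rule_rels_def\<close>)

lemma equivalent_mset_subst:
  assumes "\<And>x. x \<in># m \<Longrightarrow> {#x#} \<approx> \<phi> x" "m \<in> free_cm X"
    and "\<And>x. x \<in># m \<Longrightarrow> \<phi> x \<in> free_cm X"
  shows "m \<approx> mset_subst \<phi> m"
  using assms
proof (induction m)
  case empty
  then show ?case by (simp add: pres_cong.refl)
next
  case (add x m)
  then have "{#x#} + m \<approx> \<phi> x + mset_subst \<phi> m"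
    by (intro pres_cong_add_cong) auto
  then show ?case by simp
qed

lemma reachable_equivalent:
  assumes "(u, v) \<in> (rule_edges P)\<^sup>*" "u \<in> X"
  shows "\<exists>x \<in> free_cm X. {#u#} \<approx> add_mset v x"
  using assms
proof (induction rule: rtrancl_induct)
  case base
  then show ?case
    by (intro bexI[of _ "{#}"]) (auto intro: pres_cong.refl)
next
  case (step v y)
  then obtain x where x: "x \<in> free_cm X" "{#u#} \<approx> {#v#} + x"
    by auto
  from step(2) obtain m where m: "(v, m) \<in> P" "y \<in># m"
    by (auto simp: rule_edges_def)
  then obtain m' where m': "m = add_mset y m'"
    by (meson mset_add)
  have "{#v#} + x \<approx> m + x"
    using rule_equivalent m(1) x(1) by (intro pres_cong.add) auto
  then have "{#u#} \<approx> add_mset y (m' + x)"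
    using x(2) pres_cong.trans by (fastforce simp: m')
  moreover have "m' + x \<in> free_cm X"
    using rule_closed(2)[OF m(1)] x(1) m' by simp
  ultimately show ?case by blast
qed

text \<open>
  Going once around a closed walk at \<open>u\<close> turns \<open>u\<close> into \<open>u\<close> plus everything that was split off on the
  way.  If the first step already splits off something, cancelling \<open>u\<close> equates a nonempty multiset
  with the empty one.
\<close>

lemma cancellative_imp_rigid:
  assumes cancel: "comm_monoid_cancel (pres_monoid X (rule_rels P))"
  shows rigid
  unfolding rigid_def
proof (intro ballI, clarify, rule ccontr)
  fix u m
  assume m: "(u, m) \<in> P" and cyclic: "(u, u) \<in> (rule_edges P)\<^sup>+"
  assume "size m \<noteq> 1"
  from cyclic obtain y where y: "(u, y) \<in> rule_edges P" "(y, u) \<in> (rule_edges P)\<^sup>*"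
    by (meson tranclD)
  with rule_unique[OF m] have "y \<in># m"
    by (auto simp: rule_edges_def)
  then obtain t where t: "m = add_mset y t"
    by (meson mset_add)
  with \<open>size m \<noteq> 1\<close> have "t \<noteq> {#}" by auto
  have free: "u \<in> X" "y \<in> X" "t \<in> free_cm X"
    using rule_closed[OF m] t by auto
  obtain x where x: "x \<in> free_cm X" "{#y#} \<approx> add_mset u x"
    using reachable_equivalent[OF y(2) free(2)] by blast
  have "{#u#} \<approx> {#y#} + t"
    using rule_equivalent[OF m] t by simp
  from pres_cong.trans[OF this pres_cong.add[OF x(2) free(3)]]
  have "{#} + {#u#} \<approx> (x + t) + {#u#}"
    by simp
  then have "{#} \<approx> x + t"
    using cancel free x(1) unfolding comm_monoid_cancel_pres_monoid_iff[OF rule_rels_free]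
    by (metis free_cm_simps)
  then show False
    using equivalent_empty_iff \<open>t \<noteq> {#}\<close> by fastforce
qed

text \<open>
  Without exits one cannot leave a closed walk: each generator on it has only one successor, and
  that successor leads back to the start.
\<close>

lemma cyclic_reachable_back:
  assumes rigid
    and v: "(v, v) \<in> (rule_edges P)\<^sup>+" and "(v, u) \<in> (rule_edges P)\<^sup>*"
  shows "(u, v) \<in> (rule_edges P)\<^sup>*"
  using assms(3)
proof (induction rule: rtrancl_induct)
  case base
  show ?case by simp
next
  case (step u y)
  then have "(u, u) \<in> (rule_edges P)\<^sup>+"
    using v by (meson rtrancl_trancl_trancl trancl_rtrancl_trancl)
  moreover obtain m where m: "(u, m) \<in> P" "y \<in># m"
    using step(2) by (auto simp: rule_edges_def)
  ultimately have "size m = 1"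
    using rigidD[OF \<open>rigid\<close>] by blast
  then have "m = {#y#}"
    using m(2) by (metis size_1_singleton_mset set_mset_single singletonD)
  have "(u, v) \<in> (rule_edges P)\<^sup>+"
    using v step by (meson rtrancl_trancl_trancl)
  then obtain z where z: "(u, z) \<in> rule_edges P" "(z, v) \<in> (rule_edges P)\<^sup>*"
    by (meson tranclD)
  then have "z = y"
    using rule_unique[OF m(1)] \<open>m = {#y#}\<close> by (fastforce simp: rule_edges_def)
  with z show ?case by simp
qed

text \<open>
  The substitution solves the rules in \<open>S\<close> and stays within the class of each generator.
  The remaining clauses keep the induction of \<open>finite_elimination\<close> going.  A generator without a
  rule in \<open>S\<close> is still untouched when its own rule is added.  Images consist of reachable
  generators, so a generator that reappears in its own solution lies on a closed walk; and
  generators on closed walks have one-element images, so in that case the solution is the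
  generator itself.
\<close>

definition eliminates :: "('g \<times> 'g multiset) set \<Rightarrow> ('g \<Rightarrow> 'g multiset) \<Rightarrow> bool" where
  "eliminates S \<phi> \<longleftrightarrow>
    (\<forall>u m. (u, m) \<in> S \<longrightarrow> \<phi> u = mset_subst \<phi> m) \<and>
    (\<forall>v. v \<notin> Domain S \<longrightarrow> \<phi> v = {#v#}) \<and>
    (\<forall>v\<in>X. {#v#} \<approx> \<phi> v) \<and>
    (\<forall>v\<in>X. \<phi> v \<in> free_cm X) \<and>
    (\<forall>v. \<forall>x\<in>#\<phi> v. (v, x) \<in> (rule_edges P)\<^sup>*) \<and>
    (\<forall>v. (v, v) \<in> (rule_edges P)\<^sup>+ \<longrightarrow> size (\<phi> v) = 1)"

text \<open>
  Gaussian elimination, adding one rule \<open>u \<rightarrow> s\<close> at a time.  Let \<open>m\<close> be the image of \<open>s\<close> under the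
  substitution found so far.  If \<open>u\<close> does not occur in \<open>m\<close>, one substitutes \<open>m\<close> for \<open>u\<close> everywhere.
  If it does, then \<open>u\<close> lies on a closed walk, and rigidity forces \<open>m = {#u#}\<close>: the new rule holds
  already.
\<close>

lemma finite_elimination:
  assumes rigid
    and "finite S" "S \<subseteq> P"
  shows "\<exists>\<phi>. eliminates S \<phi>"
  using \<open>finite S\<close> \<open>S \<subseteq> P\<close>
proof (induction S)
  case empty
  show ?case
    by (intro exI[of _ "\<lambda>v. {#v#}"]) (auto simp: eliminates_def intro: pres_cong.refl)
next
  case (insert p S)
  obtain u s where p: "p = (u, s)" by force
  have us: "(u, s) \<in> P" using insert p by auto
  have edge: "(u, y) \<in> rule_edges P" if "y \<in># s" for y
    using that us by (auto simp: rule_edges_def)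
  from insert obtain \<phi> where "eliminates S \<phi>"
    by auto
  then have solves: "\<And>u m. (u, m) \<in> S \<Longrightarrow> \<phi> u = mset_subst \<phi> m"
    and outside: "\<And>v. v \<notin> Domain S \<Longrightarrow> \<phi> v = {#v#}"
    and equiv: "\<And>v. v \<in> X \<Longrightarrow> {#v#} \<approx> \<phi> v" "\<And>v. v \<in> X \<Longrightarrow> \<phi> v \<in> free_cm X"
    and reach: "\<And>v x. x \<in># \<phi> v \<Longrightarrow> (v, x) \<in> (rule_edges P)\<^sup>*"
    and cyclic: "\<And>v. (v, v) \<in> (rule_edges P)\<^sup>+ \<Longrightarrow> size (\<phi> v) = 1"
    unfolding eliminates_def by blast+
  have "u \<notin> Domain S"
    using insert p rule_unique[OF us] by blast
  then have \<phi>u: "\<phi> u = {#u#}" by (rule outside)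
  define m where "m = mset_subst \<phi> s"
  have reach_m: "(u, x) \<in> (rule_edges P)\<^sup>+" if "x \<in># m" for x
    using that edge reach unfolding m_def by (auto intro: rtrancl_into_trancl2)
  have size_m: "size m = 1" if u: "(u, u) \<in> (rule_edges P)\<^sup>+"
  proof -
    obtain y where y: "s = {#y#}"
      using rigidD[OF \<open>rigid\<close> us u] size_1_singleton_mset by blast
    then have "(y, u) \<in> (rule_edges P)\<^sup>*"
      using edge by (intro cyclic_reachable_back[OF \<open>rigid\<close> u]) auto
    then have "(y, y) \<in> (rule_edges P)\<^sup>+"
      using edge y by (auto intro: rtrancl_into_trancl1)
    then show ?thesis
      using cyclic by (simp add: m_def y)
  qed
  show ?case
  proof (cases "u \<in># m")
    case True
    then have "size m = 1" using reach_m size_m by blast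
    then have "m = {#u#}"
      using True by (metis size_1_singleton_mset set_mset_single singletonD)
    then have "\<phi> u = mset_subst \<phi> s"
      using \<phi>u by (simp add: m_def)
    then show ?thesis
      using solves outside equiv reach cyclic p
      by (intro exI[of _ \<phi>]) (auto simp: eliminates_def)
  next
    case False
    define \<psi> where "\<psi> = (\<lambda>x. {#x#})(u := m)"
    define \<phi>' where "\<phi>' v = mset_subst \<psi> (\<phi> v)" for v
    have sX: "x \<in> X" if "x \<in># s" for x
      using rule_closed(2)[OF us] that by (auto simp: free_cm_def)
    have m_free: "m \<in> free_cm X"
      using sX equiv(2) by (fastforce simp: m_def free_cm_def)
    have "s \<approx> m"
      unfolding m_def using sX equiv rule_closed(2)[OF us] by (intro equivalent_mset_subst) auto
    with rule_equivalent[OF us] have "{#u#} \<approx> m"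
      by (rule pres_cong.trans)
    then have \<psi>: "{#x#} \<approx> \<psi> x" "\<psi> x \<in> free_cm X" if "x \<in> X" for x
      using that m_free by (auto simp: \<psi>_def intro: pres_cong.refl)
    have "\<phi>' u = mset_subst \<phi>' s"
    proof -
      have "mset_subst \<phi>' s = mset_subst \<psi> m"
        by (simp add: \<phi>'_def[abs_def] m_def mset_subst_mset_subst)
      also have "\<dots> = m"
        using False by (intro mset_subst_id) (auto simp: \<psi>_def)
      finally show ?thesis
        by (simp add: \<phi>'_def \<phi>u \<psi>_def)
    qed
    moreover have "\<phi>' v = mset_subst \<phi>' t" if "(v, t) \<in> S" for v t
      using solves[OF that] by (simp add: \<phi>'_def[abs_def] mset_subst_mset_subst)
    moreover have "\<phi>' v = {#v#}" if "v \<notin> Domain (insert p S)" for v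
      using outside[of v] that by (auto simp: \<phi>'_def \<psi>_def p)
    moreover have "{#v#} \<approx> \<phi>' v \<and> \<phi>' v \<in> free_cm X" if v: "v \<in> X" for v
    proof
      have X: "x \<in> X" if "x \<in># \<phi> v" for x
        using equiv(2)[OF v] that by (auto simp: free_cm_def)
      then show "\<phi>' v \<in> free_cm X"
        using \<psi>(2) by (fastforce simp: \<phi>'_def free_cm_def)
      show "{#v#} \<approx> \<phi>' v"
        unfolding \<phi>'_def
        by (rule pres_cong.trans[OF equiv(1)[OF v]], rule equivalent_mset_subst)
          (use X \<psi> equiv(2)[OF v] in auto)
    qed
    moreover have "(v, x) \<in> (rule_edges P)\<^sup>*" if x: "x \<in># \<phi>' v" for v x
    proof -
      obtain y where y: "y \<in># \<phi> v" "x \<in># \<psi> y"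
        using x by (auto simp: \<phi>'_def)
      moreover have "(y, x) \<in> (rule_edges P)\<^sup>*"
        using y(2) reach_m by (auto simp: \<psi>_def trancl_into_rtrancl split: if_splits)
      ultimately show ?thesis
        using reach by (meson rtrancl_trans)
    qed
    moreover have "size (\<phi>' v) = 1" if v: "(v, v) \<in> (rule_edges P)\<^sup>+" for v
    proof -
      obtain x where x: "\<phi> v = {#x#}"
        using cyclic[OF v] size_1_singleton_mset by blast
      have "size (\<psi> x) = 1"
      proof (cases "x = u")
        case True
        then have "(v, u) \<in> (rule_edges P)\<^sup>*"
          using reach x by auto
        then have "(u, u) \<in> (rule_edges P)\<^sup>+"
          using cyclic_reachable_back[OF \<open>rigid\<close> v] v
          by (meson rtrancl_trancl_trancl trancl_rtrancl_trancl)
        then show ?thesis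
          using size_m True by (simp add: \<psi>_def)
      qed (simp add: \<psi>_def)
      then show ?thesis
        by (simp add: \<phi>'_def x)
    qed
    ultimately show ?thesis
      using p by (intro exI[of _ \<phi>']) (auto simp: eliminates_def)
  qed
qed

text \<open>
  A derivation uses only finitely many rules, so a substitution that solves these identifies both
  of its ends.  Only finite sets of rules are ever solved because infinitely many rules need not
  have a common solution by nonempty multisets: the rules \<open>v\<^sub>i \<rightarrow> v\<^sub>i\<^sub>+\<^sub>1 + v\<^sub>i\<^sub>+\<^sub>1\<close> would make the
  image of \<open>v\<^sub>0\<close> divisible by every power of two.
\<close>

lemma equivalent_finite_support:
  assumes "a \<approx> b"
  shows "\<exists>S\<subseteq>P. finite S \<and>
    (\<forall>\<phi>. (\<forall>(u, m)\<in>S. \<phi> u = mset_subst \<phi> m) \<longrightarrow> mset_subst \<phi> a = mset_subst \<phi> b)"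
  using assms
proof (induction rule: pres_cong.induct)
  case (rel a b)
  then obtain u where "(u, b) \<in> P" "a = {#u#}"
    by (auto simp: rule_rels_def)
  then show ?case
    by (intro exI[of _ "{(u, b)}"]) auto
next
  case (trans a b c)
  then obtain S T where "S \<subseteq> P" "finite S" "T \<subseteq> P" "finite T"
    and "\<forall>\<phi>. (\<forall>(u, m)\<in>S. \<phi> u = mset_subst \<phi> m) \<longrightarrow> mset_subst \<phi> a = mset_subst \<phi> b"
    and "\<forall>\<phi>. (\<forall>(u, m)\<in>T. \<phi> u = mset_subst \<phi> m) \<longrightarrow> mset_subst \<phi> b = mset_subst \<phi> c"
    by blast
  then show ?case
    by (intro exI[of _ "S \<union> T"]) auto
next
  case (refl a)
  show ?case by (intro exI[of _ "{}"]) simp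
next
  case (sym a b)
  then show ?case by metis
next
  case (add a b c)
  then show ?case by (metis mset_subst_simps(3))
qed

lemma rigid_imp_cancellative:
  assumes rigid
  shows "comm_monoid_cancel (pres_monoid X (rule_rels P))"
  unfolding comm_monoid_cancel_pres_monoid_iff[OF rule_rels_free]
proof (intro ballI impI)
  fix a b c
  assume free: "a \<in> free_cm X" "b \<in> free_cm X" "c \<in> free_cm X" and eq: "a + b \<approx> c + b"
  obtain S where S: "S \<subseteq> P" "finite S" and
    subst: "\<And>\<phi>. (\<forall>(u, m)\<in>S. \<phi> u = mset_subst \<phi> m) \<Longrightarrow> mset_subst \<phi> (a + b) = mset_subst \<phi> (c + b)"
    using equivalent_finite_support[OF eq] by blast
  obtain \<phi> where \<phi>: "eliminates S \<phi>"
    using finite_elimination[OF \<open>rigid\<close> S(2,1)] by blast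
  have "mset_subst \<phi> a = mset_subst \<phi> c"
    using subst[of \<phi>] \<phi> by (auto simp: eliminates_def)
  moreover have "m \<approx> mset_subst \<phi> m" if "m \<in> free_cm X" for m
    using that \<phi> by (intro equivalent_mset_subst) (auto simp: free_cm_def eliminates_def)
  ultimately show "a \<approx> c"
    using free by (metis pres_cong.sym pres_cong.trans)
qed

theorem cancellative_iff_rigid:
  "comm_monoid_cancel (pres_monoid X (rule_rels P)) \<longleftrightarrow>
    (\<forall>(u, m)\<in>P. (u, u) \<in> (rule_edges P)\<^sup>+ \<longrightarrow> size m = 1)"
  unfolding rigid_def[symmetric]
  using cancellative_imp_rigid rigid_imp_cancellative by blast

end

text \<open>
  Relations may be read in either direction: the congruence that they generate is symmetric.
  This is what makes it possible to orient each relation of $M(E,w)$ as a rule for one generator.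
\<close>

lemma pres_monoid_cong:
  assumes "\<And>a b. (a, b) \<in> R \<Longrightarrow> (a, b) \<in> R' \<or> (b, a) \<in> R'"
    and "\<And>a b. (a, b) \<in> R' \<Longrightarrow> (a, b) \<in> R \<or> (b, a) \<in> R"
  shows "pres_monoid X R = pres_monoid X R'"
proof -
  have mono: "pres_cong X T a b"
    if "pres_cong X S a b" "\<And>a b. (a, b) \<in> S \<Longrightarrow> (a, b) \<in> T \<or> (b, a) \<in> T" for S T a b
    using that(1) by induction (use that(2) in \<open>blast intro: pres_cong.intros\<close>)+
  have "pres_cong X R = pres_cong X R'"
    using mono assms by (intro ext) metis
  then show ?thesis
    by (simp add: pres_monoid_def pres_class_def fun_eq_iff)
qed

section \<open>Cycles and reachability\<close>

context wf_digraph
begin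

lemma reachable1_imp_cycle_at:
  assumes "x \<rightarrow>\<^sup>+ x"
  obtains C where "cycle_at G x C"
proof -
  from assms obtain y where y: "(x, y) \<in> arcs_ends G" "(y, x) \<in> (arcs_ends G)\<^sup>*"
    by (meson tranclD)
  then obtain e where e: "e \<in> arcs G" "tail G e = x" "head G e = y"
    by (auto simp: arcs_ends_def arc_to_ends_def)
  have "y \<rightarrow>\<^sup>* x"
    using y e by (metis head_in_verts reachable1_reachable reachable_refl rtranclD)
  then obtain p where "apath y p x"
    by (auto simp: reachable_apath)
  then have "cycle_at G x (e # p)"
    using e by (auto simp: cycle_at_def cycle_def apath_def awalk_Cons_iff)
  then show thesis by (rule that)
qed

lemma cycle_rotate:
  assumes "cycle C" "e \<in> set C"
  obtains p where "awalk (tail G e) (e # p) (tail G e)" "set (e # p) = set C"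
proof -
  obtain p q where C: "C = p @ e # q"
    using \<open>e \<in> set C\<close> by (meson split_list)
  then have "awalk (tail G e) (e # (q @ p)) (tail G e)"
    using \<open>cycle C\<close> by (auto simp: cycle_def awalk_Cons_iff)
  then show thesis
    using C by (intro that[of "q @ p"]) auto
qed

lemma cycle_imp_reachable1:
  assumes "cycle C" "e \<in> set C"
  shows "tail G e \<rightarrow>\<^sup>+ tail G e"
  using cycle_rotate[OF assms] by (metis list.distinct(1) reachable1_awalkI)

lemma cycle_successor:
  assumes "cycle C" "e \<in> set C"
  obtains f where "f \<in> set C" "tail G f = head G e"
proof -
  obtain p where p: "awalk (tail G e) (e # p) (tail G e)" "set (e # p) = set C"
    using cycle_rotate[OF assms] .
  show thesis
  proof (cases p)
    case Nil
    with p show ?thesis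
      by (intro that[of e]) (auto simp: awalk_simps)
  next
    case (Cons f q)
    with p show ?thesis
      by (intro that[of f]) (auto simp: awalk_simps)
  qed
qed

lemma cycle_arcs: "cycle C \<Longrightarrow> set C \<subseteq> arcs G"
  by (auto simp: cycle_def)

lemma cycle_inj_on_head:
  assumes "cycle C"
  shows "inj_on (head G) (set C)"
proof -
  have "awalk_verts u p = u # map (head G) p" if "cas u p v" for u p v
    using that by (induction p arbitrary: u) auto
  then show ?thesis
    using assms by (auto simp: cycle_def awalk_def distinct_map)
qed

lemma cycle_inj_on_tail:
  assumes "cycle C"
  shows "inj_on (tail G) (set C)"
  using assms cycle_at_iff[of "tail G (hd C)" C] by (simp add: cycle_at_def distinct_map)

text \<open>
  Reachability of edges is used in place of reachability of vertices because it treats a weighted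
  edge and the edges behind its range alike, and because on the edges that follow a weighted edge
  it comes from a deterministic step relation.
\<close>

definition arc_step :: "('b \<times> 'b) set" where
  "arc_step = {(e, f). e \<in> arcs G \<and> f \<in> arcs G \<and> head G e = tail G f}"

lemma reachable_imp_arc_steps:
  assumes "head G e \<rightarrow>\<^sup>* tail G f" "e \<in> arcs G" "f \<in> arcs G"
  shows "(e, f) \<in> arc_step\<^sup>*"
  using assms(1,3)
proof (induction "tail G f" arbitrary: f rule: reachable_induct)
  case base
  then have "(e, f) \<in> arc_step"
    using \<open>e \<in> arcs G\<close> by (auto simp: arc_step_def)
  then show ?case by blast
next
  case (step x)
  then obtain d where d: "d \<in> arcs G" "tail G d = x" "head G d = tail G f"
    by (auto simp: arcs_ends_def arc_to_ends_def)
  then have "(e, d) \<in> arc_step\<^sup>*"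
    using step by blast
  moreover have "(d, f) \<in> arc_step"
    using d \<open>f \<in> arcs G\<close> by (simp add: arc_step_def)
  ultimately show ?case by simp
qed

lemma arc_step_imp_adj: "(e, f) \<in> arc_step \<Longrightarrow> (head G e, head G f) \<in> arcs_ends G"
  by (auto simp: arc_step_def arcs_ends_def arc_to_ends_def)

lemma arc_steps_imp_reachable1: "(e, f) \<in> arc_step\<^sup>+ \<Longrightarrow> head G e \<rightarrow>\<^sup>+ head G f"
  by (induction rule: trancl_induct) (auto dest!: arc_step_imp_adj)

lemma arc_steps_imp_reachable:
  "(e, f) \<in> arc_step\<^sup>* \<Longrightarrow> e \<in> arcs G \<Longrightarrow> head G e \<rightarrow>\<^sup>* head G f"
  by (metis arc_steps_imp_reachable1 head_in_verts reachable1_reachable reachable_refl rtranclD)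

end

section \<open>The edges that follow a weighted edge\<close>

context lpa_weighted_graph
begin

abbreviation Z :: "'a set" where
  "Z \<equiv> weighted_down G w"

lemma in_Z_iff: "x \<in> Z \<longleftrightarrow> (\<exists>g\<in>weighted_arcs G w. head G g \<rightarrow>\<^sup>*\<^bsub>G\<^esub> x)"
  by (auto simp: weighted_down_def down_sets_def down_set_def)

lemma weighted_arcs_iff: "e \<in> weighted_arcs G w \<longleftrightarrow> e \<in> arcs G \<and> w e > 1"
  by (simp add: weighted_arcs_def)

lemma Z_closed: "e \<in> arcs G \<Longrightarrow> tail G e \<in> Z \<Longrightarrow> head G e \<in> Z"
  unfolding in_Z_iff by (meson reachable_adj_trans in_arcs_imp_in_arcs_ends)

lemma head_weighted_in_Z: "e \<in> weighted_arcs G w \<Longrightarrow> head G e \<in> Z"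
  unfolding in_Z_iff weighted_arcs_iff
  by (intro bexI[of _ e] reachable_refl) (auto simp: weighted_arcs_iff)

text \<open>
  The edges whose relation is read from right to left.  They are the reversed edges of $E'$
  together with the weighted edges of $E'$, which give the bar edges of its auxiliary graph.
  Equivalently, by \<open>returned_arcs_iff\<close>, they are the weighted edges and all edges that follow one.
\<close>

definition returned_arcs :: "'b set" where
  "returned_arcs = {e \<in> arcs G. tail G e \<in> Z \<or> w e > 1}"

lemma returned_arcs_iff:
  "e \<in> returned_arcs \<longleftrightarrow> (\<exists>g\<in>weighted_arcs G w. (g, e) \<in> arc_step\<^sup>*)"
proof
  assume "e \<in> returned_arcs"
  then show "\<exists>g\<in>weighted_arcs G w. (g, e) \<in> arc_step\<^sup>*"
    unfolding returned_arcs_def in_Z_iff weighted_arcs_def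
    by (blast intro: reachable_imp_arc_steps)
next
  assume "\<exists>g\<in>weighted_arcs G w. (g, e) \<in> arc_step\<^sup>*"
  then obtain g where g: "g \<in> weighted_arcs G w" "(g, e) \<in> arc_step\<^sup>*" by blast
  from g(2,1) show "e \<in> returned_arcs"
  proof cases
    case (step d)
    then have "head G g \<rightarrow>\<^sup>*\<^bsub>G\<^esub> tail G e"
      using g(1) arc_steps_imp_reachable[of g d] by (auto simp: arc_step_def weighted_arcs_iff)
    then show ?thesis
      using step g(1) by (auto simp: returned_arcs_def in_Z_iff arc_step_def)
  qed (auto simp: returned_arcs_def weighted_arcs_iff)
qed

lemma returned_arcs_arcs: "e \<in> returned_arcs \<Longrightarrow> e \<in> arcs G"
  by (simp add: returned_arcs_def)

lemma head_returned_in_Z: "e \<in> returned_arcs \<Longrightarrow> head G e \<in> Z"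
  using Z_closed head_weighted_in_Z by (auto simp: returned_arcs_def weighted_arcs_iff)

lemma returned_arcs_step: "e \<in> returned_arcs \<Longrightarrow> (e, f) \<in> arc_step \<Longrightarrow> f \<in> returned_arcs"
  unfolding returned_arcs_iff by (meson rtrancl.rtrancl_into_rtrancl)

lemma arc_step_deterministic:
  assumes "e \<in> returned_arcs" "(e, f) \<in> arc_step" "(e, f') \<in> arc_step"
  shows "f = f'"
  using assms LPA2[OF head_returned_in_Z] by (auto simp: arc_step_def)

text \<open>
  By (LPA2) the step relation is deterministic here, so two edges that follow the same edge
  lie on one walk, one behind the other.
\<close>

lemma arc_steps_comparable:
  assumes "(e, f') \<in> arc_step\<^sup>*" "e \<in> returned_arcs" "(e, f) \<in> arc_step\<^sup>*"
  shows "(f, f') \<in> arc_step\<^sup>* \<or> (f', f) \<in> arc_step\<^sup>*"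
  using assms(3)
proof (induction rule: rtrancl_induct)
  case base
  then show ?case using assms by simp
next
  case (step f g)
  have "f \<in> returned_arcs"
    using step(1) assms(2) by induction (auto intro: returned_arcs_step)
  from step.IH show ?case
  proof
    assume "(f, f') \<in> arc_step\<^sup>*"
    then show ?thesis
    proof (cases rule: converse_rtranclE)
      case base
      then show ?thesis using step(2) by blast
    next
      case (step h)
      then show ?thesis
        using arc_step_deterministic[OF \<open>f \<in> returned_arcs\<close> _ \<open>(f, g) \<in> arc_step\<close>] by blast
    qed
  next
    assume "(f', f) \<in> arc_step\<^sup>*"
    then show ?thesis using step(2) by (meson rtrancl.rtrancl_into_rtrancl)
  qed
qed

text \<open>
  Weighted edges whose ranges lead to a common vertex are in line by (LPA3), hence one of them
  precedes both of the given edges.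
\<close>

lemma returned_arcs_common_weighted:
  assumes "e \<in> returned_arcs" "f \<in> returned_arcs" "head G e = head G f"
  obtains g where "g \<in> weighted_arcs G w" "(g, e) \<in> arc_step\<^sup>*" "(g, f) \<in> arc_step\<^sup>*"
proof -
  obtain g h where g: "g \<in> weighted_arcs G w" "(g, e) \<in> arc_step\<^sup>*"
    and h: "h \<in> weighted_arcs G w" "(h, f) \<in> arc_step\<^sup>*"
    using assms unfolding returned_arcs_iff by blast
  have arcs: "g \<in> arcs G" "h \<in> arcs G"
    using g h by (auto simp: weighted_arcs_iff)
  have "head G g \<rightarrow>\<^sup>*\<^bsub>G\<^esub> head G e" "head G h \<rightarrow>\<^sup>*\<^bsub>G\<^esub> head G e"
    using arc_steps_imp_reachable g(2) h(2) arcs assms(3) by metis+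
  then have "in_line G g h"
    using LPA3[OF g(1) h(1)] by (auto simp: down_set_def)
  then have "(g, h) \<in> arc_step\<^sup>* \<or> (h, g) \<in> arc_step\<^sup>*"
    using arcs by (auto simp: in_line_def intro: reachable_imp_arc_steps)
  then show thesis
    using that[OF g] that[OF h(1) _ h(2)] g(2) h(2) by (meson rtrancl_trans)
qed

text \<open>
  Where every vertex emits only one edge, a walk that is on a cycle stays on it.
\<close>

lemma cycle_in_Z_closed:
  assumes "cycle C" "d \<in> set C" "d \<in> returned_arcs" "(d, e) \<in> arc_step\<^sup>*"
  shows "e \<in> set C"
  using assms(4)
proof (induction rule: rtrancl_induct)
  case (step e f)
  have e: "e \<in> returned_arcs"
    using step(1) assms(3) by induction (auto intro: returned_arcs_step)
  obtain f' where f': "f' \<in> set C" "tail G f' = head G e"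
    using cycle_successor[OF assms(1) step.IH] .
  then have "(e, f') \<in> arc_step"
    using cycle_arcs[OF assms(1)] step(2) by (auto simp: arc_step_def)
  then show ?case
    using arc_step_deterministic[OF e step(2)] f'(1) by blast
qed (use assms in simp)

text \<open>
  Suppose \<open>e \<noteq> f\<close> have the same range.  Both follow one weighted edge \<open>g\<close>, so one of them follows
  the other, and their common range lies on a cycle.  By (LPA4) this cycle passes through \<open>g\<close>, and
  by (LPA2) it then contains every edge that follows \<open>g\<close>, in particular \<open>e\<close> and \<open>f\<close>.  But the edges
  of a cycle have distinct ranges.
\<close>

lemma inj_on_head_returned_arcs: "inj_on (head G) returned_arcs"
proof (rule inj_onI, rule ccontr)
  fix e f
  assume ef: "e \<in> returned_arcs" "f \<in> returned_arcs" "head G e = head G f" "e \<noteq> f"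
  then obtain g where g: "g \<in> weighted_arcs G w" "(g, e) \<in> arc_step\<^sup>*" "(g, f) \<in> arc_step\<^sup>*"
    using returned_arcs_common_weighted by blast
  then have g': "g \<in> returned_arcs" "g \<in> arcs G"
    by (auto simp: returned_arcs_def weighted_arcs_iff)
  have "(e, f) \<in> arc_step\<^sup>+ \<or> (f, e) \<in> arc_step\<^sup>+"
    using arc_steps_comparable[OF g(3) g'(1) g(2)] ef(4) by (metis rtranclD)
  then have "head G e \<rightarrow>\<^sup>+\<^bsub>G\<^esub> head G e"
    using arc_steps_imp_reachable1 ef(3) by metis
  then obtain C where C: "cycle_at G (head G e) C"
    by (rule reachable1_imp_cycle_at)
  then have "cycle C"
    by (simp add: cycle_at_def)
  have "g \<in> set C"
    using g C arc_steps_imp_reachable[OF g(2) g'(2)] by (intro LPA4) (auto simp: down_set_def)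
  then have "e \<in> set C" "f \<in> set C"
    using cycle_in_Z_closed[OF \<open>cycle C\<close> _ g'(1)] g by blast+
  then show False
    using cycle_inj_on_head[OF \<open>cycle C\<close>] ef(3,4) by (auto dest: inj_onD)
qed

end

section \<open>The rules of the weighted graph monoid\<close>

lemma set_mset_sum_singletons [simp]:
  "finite A \<Longrightarrow> set_mset (\<Sum>a\<in>A. {#f a#}) = f ` A"
  by (induction rule: finite_induct) auto

lemma size_sum_singletons [simp]: "finite A \<Longrightarrow> size (\<Sum>a\<in>A. {#f a#}) = card A"
  by (induction rule: finite_induct) auto

context lpa_weighted_graph
begin

definition plain_arcs :: "'a \<Rightarrow> 'b set" where
  "plain_arcs v = {e \<in> out_arcs G v. w e = 1}"

text \<open>
  A mixed vertex emits edges of two different weights, which is the most that (LPA1) permits.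
  These are the vertices with a generator $q_1^v$.
\<close>

definition mixed :: "'a \<Rightarrow> bool" where
  "mixed v \<longleftrightarrow> plain_arcs v \<noteq> {} \<and> (\<exists>f\<in>out_arcs G v. w f > 1)"

definition slack :: "'a \<Rightarrow> 'a wgm_gen multiset" where
  "slack v = (if mixed v then {#Q v 1#} else {#})"

definition forward_rhs :: "'a \<Rightarrow> 'a wgm_gen multiset" where
  "forward_rhs v = slack v + (\<Sum>e\<in>plain_arcs v. {#V (head G e)#})"

definition backward_rhs :: "'b \<Rightarrow> 'a wgm_gen multiset" where
  "backward_rhs e = slack (tail G e) +
    replicate_mset (if mixed (tail G e) then w e - 1 else w e) (V (tail G e))"

definition vertex_rules :: "('a wgm_gen \<times> 'a wgm_gen multiset) set" where
  "vertex_rules =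
    {(V v, forward_rhs v) | v. v \<in> verts G - Z \<and> plain_arcs v \<noteq> {}} \<union>
    {(V (head G e), backward_rhs e) | e. e \<in> returned_arcs}"

lemma finite_plain_arcs [simp]: "v \<in> verts G \<Longrightarrow> finite (plain_arcs v)"
  by (rule finite_subset[OF _ row_finite]) (auto simp: plain_arcs_def)

lemma weights_plain_arcs: "plain_arcs v \<noteq> {} \<Longrightarrow> w ` plain_arcs v = {1}"
  by (auto simp: plain_arcs_def)

lemma out_arc_cases:
  assumes "f \<in> out_arcs G v" "w f > 1"
  shows "{e \<in> out_arcs G v. w e = w f} = {f}" "out_arcs G v = insert f (plain_arcs v)"
proof -
  have v: "v \<in> verts G" using assms by auto
  have cases: "e = f \<or> w e = 1" if "e \<in> out_arcs G v" for e
    using LPA1[OF v that assms(1)] weight_pos[of e] that assms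
    by (fastforce simp: weighted_arcs_iff)
  show "{e \<in> out_arcs G v. w e = w f} = {f}"
    using assms cases by fastforce
  show "out_arcs G v = insert f (plain_arcs v)"
    unfolding plain_arcs_def using assms(1) cases by blast
qed

lemma mixed_weights:
  assumes "mixed v" "f \<in> out_arcs G v" "w f > 1"
  shows "w ` out_arcs G v = {1, w f}"
  using assms(1) weights_plain_arcs[of v]
  by (subst out_arc_cases(2)[OF assms(2,3)]) (auto simp: mixed_def)

lemma plain_weights:
  assumes "\<not> mixed v" "plain_arcs v \<noteq> {}"
  shows "out_arcs G v = plain_arcs v" "w ` out_arcs G v = {1}"
proof -
  show "out_arcs G v = plain_arcs v"
    using assms weight_pos by (force simp: mixed_def plain_arcs_def)
  then show "w ` out_arcs G v = {1}"
    using weights_plain_arcs[OF assms(2)] by simp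
qed

lemma mixed_notin_Z:
  assumes "mixed v"
  shows "v \<notin> Z"
proof
  assume "v \<in> Z"
  obtain e f where "e \<in> out_arcs G v" "w e = 1" "f \<in> out_arcs G v" "w f > 1"
    using assms by (auto simp: mixed_def plain_arcs_def)
  then show False
    using LPA2[OF \<open>v \<in> Z\<close>] by force
qed

text \<open>
  At a mixed vertex the two weights are $1$ and $w(f)$, so the first relation is
  $v = q_1^v + \<Sum> r(e)$ over the unweighted edges and the second one is
  $q_1^v + (w(f) - 1) v = r(f)$.
\<close>

lemma mixed_relations:
  assumes "mixed v" "f \<in> out_arcs G v" "w f > 1"
  shows "num_weights G w v = 2"
    "wgm_lhs G w v 1 = {#V v#}" "wgm_rhs G w v 1 = forward_rhs v"
    "wgm_lhs G w v 2 = backward_rhs f" "wgm_rhs G w v 2 = {#V (head G f)#}"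
proof -
  note ws = mixed_weights[OF assms]
  show num: "num_weights G w v = 2"
    using assms(3) by (simp add: num_weights_def ws)
  have "sorted_list_of_set {1, w f} = [1, w f]"
    using assms(3) by (simp add: sorted_list_of_set_nonempty)
  then have at: "weight_at G w v 0 = 0" "weight_at G w v 1 = 1" "weight_at G w v 2 = w f"
    by (simp_all add: weight_at_def ws)
  have tail: "tail G f = v" using assms by simp
  show "wgm_lhs G w v 1 = {#V v#}" "wgm_rhs G w v 1 = forward_rhs v"
    using assms(1) at num
    by (simp_all add: wgm_lhs_def wgm_rhs_def wgm_q_def forward_rhs_def slack_def plain_arcs_def)
  show "wgm_lhs G w v 2 = backward_rhs f" "wgm_rhs G w v 2 = {#V (head G f)#}"
    using assms(1) at num tail out_arc_cases(1)[OF assms(2,3)]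
    by (simp_all add: wgm_lhs_def wgm_rhs_def wgm_q_def backward_rhs_def slack_def)
qed

lemma uniform_relations:
  assumes "\<not> mixed v" "e \<in> out_arcs G v"
  shows "num_weights G w v = 1"
    "wgm_lhs G w v 1 = replicate_mset (w e) (V v)"
    "wgm_rhs G w v 1 = (\<Sum>e\<in>out_arcs G v. {#V (head G e)#})"
proof -
  have ws: "w ` out_arcs G v = {w e}"
  proof (cases "plain_arcs v = {}")
    case True
    then have "w e > 1"
      using assms weight_pos[of e] by (auto simp: plain_arcs_def)
    from out_arc_cases(2)[OF assms(2) this] True show ?thesis by simp
  next
    case False
    have "w e \<in> w ` out_arcs G v"
      using assms(2) by (rule imageI)
    then show ?thesis
      unfolding plain_weights(2)[OF assms(1) False] by simp
  qed
  show num: "num_weights G w v = 1"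
    by (simp add: num_weights_def ws)
  have "weight_at G w v 0 = 0" "weight_at G w v 1 = w e"
    by (simp_all add: weight_at_def ws)
  moreover have "{f \<in> out_arcs G v. w f = w e} = out_arcs G v"
    using ws by blast
  ultimately show "wgm_lhs G w v 1 = replicate_mset (w e) (V v)"
    "wgm_rhs G w v 1 = (\<Sum>e\<in>out_arcs G v. {#V (head G e)#})"
    using num by (simp_all add: wgm_lhs_def wgm_rhs_def wgm_q_def)
qed

lemma forward_relation:
  assumes "plain_arcs v \<noteq> {}"
  shows "num_weights G w v \<ge> 1" "wgm_lhs G w v 1 = {#V v#}" "wgm_rhs G w v 1 = forward_rhs v"
proof -
  have "num_weights G w v \<ge> 1 \<and> wgm_lhs G w v 1 = {#V v#} \<and> wgm_rhs G w v 1 = forward_rhs v"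
  proof (cases "mixed v")
    case True
    then obtain f where "f \<in> out_arcs G v" "w f > 1"
      unfolding mixed_def by blast
    from mixed_relations[OF True this] show ?thesis by simp
  next
    case False
    obtain e where "e \<in> out_arcs G v" "w e = 1"
      using assms by (auto simp: plain_arcs_def)
    with uniform_relations[OF False this(1)] plain_weights(1)[OF False assms] show ?thesis
      using False by (simp add: forward_rhs_def slack_def)
  qed
  then show "num_weights G w v \<ge> 1" "wgm_lhs G w v 1 = {#V v#}" "wgm_rhs G w v 1 = forward_rhs v"
    by auto
qed

text \<open>
  The relation that an edge \<open>e\<close> of this kind contributes is always the last one at its source:
  either \<open>e\<close> is the only edge there, or it is weighted at a mixed vertex.
\<close>

lemma backward_relation:
  assumes e: "e \<in> returned_arcs" and v: "v = tail G e" and i: "i = num_weights G w v"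
  shows "i \<ge> 1" "wgm_lhs G w v i = backward_rhs e" "wgm_rhs G w v i = {#V (head G e)#}"
proof -
  have out: "e \<in> out_arcs G v"
    using e v by (simp add: returned_arcs_def)
  have "i \<ge> 1 \<and> wgm_lhs G w v i = backward_rhs e \<and> wgm_rhs G w v i = {#V (head G e)#}"
  proof (cases "mixed v")
    case True
    then have "w e > 1"
      using e mixed_notin_Z[OF True] v by (auto simp: returned_arcs_def)
    from mixed_relations[OF True out this] i show ?thesis by simp
  next
    case False
    have "out_arcs G v = {e}"
    proof (cases "v \<in> Z")
      case True
      then show ?thesis using LPA2[OF True] out by blast
    next
      case Zv: False
      then have "w e > 1"
        using e v by (auto simp: returned_arcs_def)
      moreover from this have "plain_arcs v = {}"
        using False out by (auto simp: mixed_def)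
      ultimately show ?thesis
        using out_arc_cases(2)[OF out] by simp
    qed
    then show ?thesis
      using uniform_relations[OF False out] False v i by (simp add: backward_rhs_def slack_def)
  qed
  then show "i \<ge> 1" "wgm_lhs G w v i = backward_rhs e" "wgm_rhs G w v i = {#V (head G e)#}"
    by auto
qed

lemma relation_cases:
  assumes v: "v \<in> verts G" and i: "1 \<le> i" "i \<le> num_weights G w v"
  obtains "v \<notin> Z" "plain_arcs v \<noteq> {}" "i = 1"
    | e where "e \<in> returned_arcs" "v = tail G e" "i = num_weights G w v"
proof (cases "mixed v")
  case True
  then obtain f where f: "f \<in> out_arcs G v" "w f > 1"
    unfolding mixed_def by blast
  then have num: "num_weights G w v = 2" by (rule mixed_relations(1)[OF True])
  show thesis
  proof (cases "i = 1")
    case True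
    then show thesis
      using that(1) mixed_notin_Z \<open>mixed v\<close> by (auto simp: mixed_def)
  next
    case False
    then show thesis
      using that(2)[of f] f num i by (auto simp: returned_arcs_def)
  qed
next
  case False
  have "out_arcs G v \<noteq> {}"
    using i by (auto simp: num_weights_def)
  then obtain e where e: "e \<in> out_arcs G v" by blast
  have num: "i = num_weights G w v" "i = 1"
    using uniform_relations(1)[OF False e] i by simp_all
  show thesis
  proof (cases "e \<in> returned_arcs")
    case True
    then show thesis using that(2)[of e] num e by simp
  next
    case False
    then have "v \<notin> Z" "w e = 1"
      using e weight_pos[of e] by (auto simp: returned_arcs_def)
    then show thesis
      using that(1) num e by (auto simp: plain_arcs_def)
  qed
qed

lemma wgm_relsI:
  "v \<in> verts G \<Longrightarrow> 1 \<le> i \<Longrightarrow> i \<le> num_weights G w v \<Longrightarrow>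
    (wgm_lhs G w v i, wgm_rhs G w v i) \<in> wgm_rels G w"
  by (auto simp: wgm_rels_def)

lemma weighted_graph_monoid_eq_rules:
  "weighted_graph_monoid G w = pres_monoid (wgm_gens G w) (rule_rels vertex_rules)"
  unfolding weighted_graph_monoid_def
proof (rule pres_monoid_cong)
  fix a b
  assume "(a, b) \<in> wgm_rels G w"
  then obtain v i where ab: "a = wgm_lhs G w v i" "b = wgm_rhs G w v i"
    and v: "v \<in> verts G" and i: "1 \<le> i" "i \<le> num_weights G w v"
    by (auto simp: wgm_rels_def)
  from v i show "(a, b) \<in> rule_rels vertex_rules \<or> (b, a) \<in> rule_rels vertex_rules"
  proof (cases rule: relation_cases)
    case 1
    then show ?thesis
      using v forward_relation[of v] by (auto simp: ab rule_rels_def vertex_rules_def)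
  next
    case (2 e)
    then show ?thesis
      using backward_relation[OF 2] by (auto simp: ab rule_rels_def vertex_rules_def)
  qed
next
  fix a b
  assume "(a, b) \<in> rule_rels vertex_rules"
  then consider v where "v \<in> verts G" "plain_arcs v \<noteq> {}" "a = {#V v#}" "b = forward_rhs v"
    | e where "e \<in> returned_arcs" "a = {#V (head G e)#}" "b = backward_rhs e"
    by (auto simp: rule_rels_def vertex_rules_def)
  then show "(a, b) \<in> wgm_rels G w \<or> (b, a) \<in> wgm_rels G w"
  proof cases
    case 1
    then show ?thesis
      using forward_relation[OF 1(2)] wgm_relsI[of v 1] by simp
  next
    case 2
    then have "tail G e \<in> verts G"
      by (auto simp: returned_arcs_def)
    then show ?thesis
      using backward_relation[OF 2(1) HOL.refl HOL.refl]
        wgm_relsI[of "tail G e" "num_weights G w (tail G e)"] by (simp add: 2)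
  qed
qed

text \<open>
  No generator has two rules: forward rules belong to vertices outside $Z$, backward rules to
  vertices of $Z$, and by \<open>inj_on_head_returned_arcs\<close> a vertex of $Z$ has at most one backward rule.
\<close>

sublocale rule_presentation "wgm_gens G w" vertex_rules
proof
  have slack: "slack v \<in> free_cm (wgm_gens G w)" if "v \<in> verts G" for v
    using that mixed_relations(1)
    by (fastforce simp: slack_def free_cm_def wgm_gens_def mixed_def)
  show "single_valued vertex_rules"
    using inj_onD[OF inj_on_head_returned_arcs] head_returned_in_Z
    by (auto simp: single_valued_def vertex_rules_def)
  fix u m
  assume "(u, m) \<in> vertex_rules"
  then consider v where "v \<in> verts G" "plain_arcs v \<noteq> {}" "u = V v" "m = forward_rhs v"
    | e where "e \<in> returned_arcs" "u = V (head G e)" "m = backward_rhs e"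
    by (auto simp: vertex_rules_def)
  then have "u \<in> wgm_gens G w \<and> m \<in> free_cm (wgm_gens G w) \<and> m \<noteq> {#}"
  proof cases
    case 1
    have "plain_arcs v \<subseteq> arcs G"
      by (auto simp: plain_arcs_def)
    then have "set_mset (\<Sum>e\<in>plain_arcs v. {#V (head G e)#}) \<subseteq> V ` verts G"
      using 1(1) by auto
    moreover have "(\<Sum>e\<in>plain_arcs v. {#V (head G e)#}) \<noteq> {#}"
      using 1(1,2) by (metis card_0_eq finite_plain_arcs size_empty size_sum_singletons)
    ultimately show ?thesis
      using 1 slack[of v] by (auto simp: forward_rhs_def wgm_gens_def free_cm_def)
  next
    case 2
    then have e: "e \<in> arcs G" "tail G e \<in> verts G" "head G e \<in> verts G" "w e \<ge> 1"
      using weight_pos by (auto simp: returned_arcs_def)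
    then show ?thesis
      using 2 slack[of "tail G e"]
      by (auto simp: backward_rhs_def slack_def wgm_gens_def free_cm_def split: if_splits)
  qed
  then show "u \<in> wgm_gens G w" "m \<in> free_cm (wgm_gens G w)" "m \<noteq> {#}"
    by auto
qed

end

section \<open>The auxiliary graph as rewriting graph\<close>

context lpa_weighted_graph
begin

abbreviation p1 :: "('a, 'b p1_edge) pre_digraph" where
  "p1 \<equiv> p1_graph G w"

abbreviation aux :: "('a, 'b p1_edge aux_edge) pre_digraph" where
  "aux \<equiv> aux_graph p1 (p1_weight w)"

lemma verts_p1 [simp]: "verts p1 = verts G"
  and tail_p1 [simp]: "tail p1 = p1_tail G"
  and head_p1 [simp]: "head p1 = p1_head G"
  by (simp_all add: p1_graph_def)

lemma arcs_p1_iff: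
  "c \<in> arcs p1 \<longleftrightarrow>
    (\<exists>e i. c = Split e i \<and> e \<in> arcs G \<and> tail G e \<in> Z \<and> 1 \<le> i \<and> i \<le> w e) \<or>
    (\<exists>e. c = Keep e \<and> e \<in> arcs G \<and> tail G e \<notin> Z)"
  by (auto simp: p1_graph_def)

lemma verts_aux [simp]: "verts aux = verts G"
  and tail_aux [simp]: "tail aux = aux_tail p1"
  and head_aux [simp]: "head aux = aux_head p1"
  by (simp_all add: aux_graph_def)

lemma arcs_aux_iff:
  "Plain c \<in> arcs aux \<longleftrightarrow> c \<in> arcs p1 \<and> p1_weight w c = 1"
  "Bar c \<in> arcs aux \<longleftrightarrow> (\<exists>e. c = Keep e \<and> e \<in> arcs G \<and> tail G e \<notin> Z \<and> w e > 1)"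
  by (auto simp: aux_graph_def unweighted_arcs_def weighted_arcs_def arcs_p1_iff)

sublocale p1: wf_digraph p1
  by unfold_locales (auto simp: arcs_p1_iff)

sublocale aux: wf_digraph aux
proof
  fix c
  assume "c \<in> arcs aux"
  then show "tail aux c \<in> verts aux" "head aux c \<in> verts aux"
    by (cases c; auto simp: arcs_aux_iff arcs_p1_iff)+
qed

lemma p1_tail_in_Z:
  assumes "c \<in> arcs p1" "p1_tail G c \<in> Z"
  obtains e i where "c = Split e i" "e \<in> returned_arcs" "tail G e \<in> Z" "1 \<le> i" "i \<le> w e"
  using assms by (auto simp: arcs_p1_iff returned_arcs_def)

lemma p1_tail_notin_Z:
  assumes "c \<in> arcs p1" "p1_tail G c \<notin> Z"
  obtains e where "c = Keep e" "e \<in> arcs G" "tail G e \<notin> Z"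
  using assms Z_closed by (auto simp: arcs_p1_iff)

lemma p1_reachable_in_Z: "x \<rightarrow>\<^sup>*\<^bsub>p1\<^esub> y \<Longrightarrow> x \<in> Z \<Longrightarrow> y \<in> Z"
  by (induction rule: p1.reachable_induct)
    (auto simp: arcs_ends_def arc_to_ends_def elim: p1_tail_in_Z)

text \<open>
  In $E'$ a walk that enters $Z$ never leaves it, since all edges starting in $Z$ are reversed edges
  between vertices of $Z$.  A weighted edge of $E'$ leads from outside $Z$ into $Z$, so it lies on no
  cycle.  Hence every cycle of $E'$ is also a cycle of the auxiliary graph.
\<close>

lemma p1_cycle_unweighted:
  assumes "p1.cycle C" "c \<in> set C"
  shows "p1_weight w c = 1"
proof (rule ccontr)
  assume "p1_weight w c \<noteq> 1"
  moreover have c: "c \<in> arcs p1"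
    using assms p1.cycle_arcs by blast
  ultimately obtain e where e: "c = Keep e" "e \<in> arcs G" "tail G e \<notin> Z" "w e \<noteq> 1"
    by (auto simp: arcs_p1_iff)
  then have "head G e \<in> Z"
    using weight_pos[of e] by (intro head_weighted_in_Z) (auto simp: weighted_arcs_iff)
  obtain p where "p1.awalk (tail p1 c) (c # p) (tail p1 c)"
    using p1.cycle_rotate[OF assms] .
  then have "p1.awalk (head G e) p (tail G e)"
    by (simp add: p1.awalk_Cons_iff e(1))
  then have "head G e \<rightarrow>\<^sup>*\<^bsub>p1\<^esub> tail G e"
    by (rule p1.reachable_awalkI)
  then show False
    using p1_reachable_in_Z \<open>head G e \<in> Z\<close> e(3) by blast
qed

lemma cycle_aux_map_Plain:
  "aux.cycle (map Plain C) \<longleftrightarrow> p1.cycle C \<and> (\<forall>c\<in>set C. p1_weight w c = 1)"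
proof -
  have "aux.cas u (map Plain C) v \<longleftrightarrow> p1.cas u C v" for u v
    by (induction C arbitrary: u) auto
  moreover have "aux.awalk_verts u (map Plain C) = p1.awalk_verts u C" for u
    by (induction C arbitrary: u) auto
  moreover have "set (map Plain C) \<subseteq> arcs aux \<longleftrightarrow>
      set C \<subseteq> arcs p1 \<and> (\<forall>c\<in>set C. p1_weight w c = 1)"
    by (auto simp: arcs_aux_iff)
  ultimately show ?thesis
    unfolding aux.cycle_def p1.cycle_def aux.awalk_def p1.awalk_def verts_p1 verts_aux by auto
qed

text \<open>
  The generator $q_1^v$ stands for the weighted edge, so the right-hand side counts all edges that
  \<open>v\<close> emits.
\<close>

lemma size_forward_rhs:
  assumes "v \<in> verts G" "plain_arcs v \<noteq> {}"
  shows "size (forward_rhs v) = card (out_arcs G v)"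
proof (cases "mixed v")
  case True
  then obtain f where f: "f \<in> out_arcs G v" "w f > 1"
    unfolding mixed_def by blast
  then have "f \<notin> plain_arcs v"
    by (auto simp: plain_arcs_def)
  then show ?thesis
    using True assms(1) out_arc_cases(2)[OF f] by (simp add: forward_rhs_def slack_def)
next
  case False
  then show ?thesis
    using assms plain_weights(1) by (simp add: forward_rhs_def slack_def)
qed

lemma size_backward_rhs: "e \<in> arcs G \<Longrightarrow> size (backward_rhs e) = w e"
  using weight_pos[of e] by (simp add: backward_rhs_def slack_def)

lemma rule_edges_iff:
  "(u, z) \<in> rule_edges vertex_rules \<longleftrightarrow>
    (\<exists>v. u = V v \<and> v \<in> verts G - Z \<and> plain_arcs v \<noteq> {} \<and> z \<in># forward_rhs v) \<or>
    (\<exists>e\<in>returned_arcs. u = V (head G e) \<and> z \<in># backward_rhs e)"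
  by (auto simp: rule_edges_def vertex_rules_def)

lemma V_in_forward_rhs:
  "v \<in> verts G \<Longrightarrow> V y \<in># forward_rhs v \<longleftrightarrow> (\<exists>e\<in>plain_arcs v. y = head G e)"
  by (auto simp: forward_rhs_def slack_def)

lemma V_in_backward_rhs:
  assumes "e \<in> returned_arcs"
  shows "V y \<in># backward_rhs e \<longleftrightarrow> y = tail G e"
proof -
  have "w e > (if mixed (tail G e) then 1 else 0)"
    using assms weight_pos[of e] mixed_notin_Z[of "tail G e"] by (auto simp: returned_arcs_def)
  then show ?thesis
    by (auto simp: backward_rhs_def slack_def)
qed

text \<open>
  The unweighted edges of $E$ that start outside $Z$ come from forward rules.  A backward rule of \<open>e\<close> leads from $r(e)$
  to $s(e)$; it corresponds to the reversed edges $e^{(i)}$ if $s(e) \<in> Z$ and to the bar edge of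
  \<open>e\<close> otherwise.
\<close>

lemma rule_edges_V_iff:
  "(V x, V y) \<in> rule_edges vertex_rules \<longleftrightarrow> (x, y) \<in> arcs_ends aux"
proof -
  have "(V x, V y) \<in> rule_edges vertex_rules \<longleftrightarrow>
      (\<exists>e\<in>arcs G. tail G e \<notin> Z \<and> w e = 1 \<and> x = tail G e \<and> y = head G e) \<or>
      (\<exists>e\<in>returned_arcs. x = head G e \<and> y = tail G e)"
  proof -
    have "(V x, V y) \<in> rule_edges vertex_rules \<longleftrightarrow>
        (x \<in> verts G - Z \<and> (\<exists>e\<in>plain_arcs x. y = head G e)) \<or>
        (\<exists>e\<in>returned_arcs. x = head G e \<and> y = tail G e)"
      by (auto simp: rule_edges_iff V_in_forward_rhs V_in_backward_rhs)
    moreover have "x \<in> verts G - Z \<and> (\<exists>e\<in>plain_arcs x. y = head G e) \<longleftrightarrow>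
        (\<exists>e\<in>arcs G. tail G e \<notin> Z \<and> w e = 1 \<and> x = tail G e \<and> y = head G e)"
      by (auto 4 4 simp: plain_arcs_def)
    ultimately show ?thesis by simp
  qed
  also have "\<dots> \<longleftrightarrow> (\<exists>c\<in>arcs aux. x = tail aux c \<and> y = head aux c)" (is "?L \<longleftrightarrow> ?R")
  proof
    assume ?L
    then consider e where "Plain (Keep e) \<in> arcs aux" "x = tail G e" "y = head G e"
      | e where "Plain (Split e 1) \<in> arcs aux" "x = head G e" "y = tail G e"
      | e where "Bar (Keep e) \<in> arcs aux" "x = head G e" "y = tail G e"
      using weight_pos by (fastforce simp: arcs_aux_iff arcs_p1_iff returned_arcs_def)
    then show ?R
      by cases force+
  next
    assume ?R
    then obtain c where c: "c \<in> arcs aux" "x = tail aux c" "y = head aux c" by blast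
    then show ?L
      by (cases c) (auto simp: arcs_aux_iff arcs_p1_iff returned_arcs_def)
  qed
  also have "\<dots> \<longleftrightarrow> (x, y) \<in> arcs_ends aux"
    by (auto simp: arcs_ends_def arc_to_ends_def)
  finally show ?thesis .
qed

text \<open>
  Walks between vertices never pass through a generator $q_1^v$, because these have no rules.
\<close>

lemma rule_edges_trancl_imp_aux:
  assumes "(V x, z) \<in> (rule_edges vertex_rules)\<^sup>+"
  shows "z = V y \<Longrightarrow> x \<rightarrow>\<^sup>+\<^bsub>aux\<^esub> y"
  using assms
proof (induction arbitrary: y rule: trancl_induct)
  case (base z)
  then show ?case by (auto simp: rule_edges_V_iff)
next
  case (step z z')
  then obtain v where "z = V v"
    by (auto simp: rule_edges_iff)
  with step show ?case
    by (metis rule_edges_V_iff trancl.trancl_into_trancl)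
qed

lemma aux_trancl_imp_rule_edges:
  "x \<rightarrow>\<^sup>+\<^bsub>aux\<^esub> y \<Longrightarrow> (V x, V y) \<in> (rule_edges vertex_rules)\<^sup>+"
  by (induction rule: trancl_induct)
    (auto simp: rule_edges_V_iff[symmetric] intro: trancl.trancl_into_trancl)

lemma cancellative_iff_aux_rigid:
  "comm_monoid_cancel (weighted_graph_monoid G w) \<longleftrightarrow>
    (\<forall>x m. (V x, m) \<in> vertex_rules \<longrightarrow> x \<rightarrow>\<^sup>+\<^bsub>aux\<^esub> x \<longrightarrow> size m = 1)"
proof -
  have "u \<in> range V" if "(u, m) \<in> vertex_rules" for u m
    using that by (auto simp: vertex_rules_def)
  then show ?thesis
    unfolding weighted_graph_monoid_eq_rules cancellative_iff_rigid
    using rule_edges_trancl_imp_aux aux_trancl_imp_rule_edges by blast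
qed

lemma rigid_out_arcs:
  assumes rigid: "\<And>m. (V x, m) \<in> vertex_rules \<Longrightarrow> size m = 1"
    and x: "x \<notin> Z" and ef: "e \<in> out_arcs G x" "w e = 1" "f \<in> out_arcs G x"
  shows "e = f"
proof -
  have v: "x \<in> verts G" "plain_arcs x \<noteq> {}"
    using ef by (auto simp: plain_arcs_def)
  then have "size (forward_rhs x) = 1"
    using x by (intro rigid) (auto simp: vertex_rules_def)
  then show ?thesis
    using size_forward_rhs[OF v] ef by (metis card_1_singletonE singletonD)
qed

text \<open>
  The cycle edge \<open>c\<close> and the exit \<open>f\<close> start at the same vertex \<open>x\<close>.  If \<open>x \<in> Z\<close>, they are two copies of
  one reversed edge, and the rule of \<open>x\<close> has at least two generators on the right; otherwise they
  are distinct edges of $E$, and again the forward rule of \<open>x\<close> is too long.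
\<close>

lemma rigid_imp_CE1:
  assumes rigid: "\<And>x m. (V x, m) \<in> vertex_rules \<Longrightarrow> x \<rightarrow>\<^sup>+\<^bsub>aux\<^esub> x \<Longrightarrow> size m = 1"
  shows "CE1 G w"
  unfolding CE1_def
proof clarify
  fix C f
  assume C: "p1.cycle C" and "is_exit p1 C f"
  then obtain c where f: "f \<in> arcs p1" "f \<notin> set C" and c: "c \<in> set C" "tail p1 c = tail p1 f"
    by (auto simp: is_exit_def)
  have arc: "c \<in> arcs p1"
    using c C p1.cycle_arcs by blast
  define x where "x = p1_tail G c"
  have x: "p1_tail G f = x"
    using c by (simp add: x_def)
  have "aux.cycle (map Plain C)"
    using C p1_cycle_unweighted by (simp add: cycle_aux_map_Plain)
  from aux.cycle_imp_reachable1[OF this, of "Plain c"] have "x \<rightarrow>\<^sup>+\<^bsub>aux\<^esub> x"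
    using c by (simp add: x_def)
  then have rigid': "size m = 1" if "(V x, m) \<in> vertex_rules" for m
    using rigid that by blast
  show False
  proof (cases "x \<in> Z")
    case True
    obtain e i where e: "c = Split e i" "e \<in> returned_arcs" "1 \<le> i" "i \<le> w e"
      using p1_tail_in_Z[OF arc] True x_def by metis
    obtain e' j where e': "f = Split e' j" "e' \<in> returned_arcs" "1 \<le> j" "j \<le> w e'"
      using p1_tail_in_Z[OF f(1)] True x by metis
    have "e' = e"
      using inj_onD[OF inj_on_head_returned_arcs _ e'(2) e(2)] e(1) e'(1) x by (simp add: x_def)
    have "size (backward_rhs e) = 1"
      using e by (intro rigid') (auto simp: vertex_rules_def x_def)
    then have "w e = 1"
      using size_backward_rhs returned_arcs_arcs e(2) by metis
    then show False
      using e e' \<open>e' = e\<close> c(1) f(2) by simp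
  next
    case False
    obtain e where e: "c = Keep e" "e \<in> arcs G"
      using p1_tail_notin_Z[OF arc] False x_def by metis
    obtain e' where e': "f = Keep e'" "e' \<in> arcs G"
      using p1_tail_notin_Z[OF f(1)] False x by metis
    have "e = e'"
      using rigid' False
    proof (rule rigid_out_arcs)
      show "w e = 1"
        using p1_cycle_unweighted[OF C c(1)] e by simp
    qed (use e e' x in \<open>auto simp: x_def\<close>)
    then show False
      using e e' c(1) f(2) by simp
  qed
qed

text \<open>
  A cycle through a bar edge continues from the source of a weighted edge, which lies outside
  $Z$, with an unweighted edge.  So this vertex is mixed, and its rule contains $q_1^v$ besides the
  next vertex of the cycle.
\<close>

lemma rigid_imp_CE2:
  assumes rigid: "\<And>x m. (V x, m) \<in> vertex_rules \<Longrightarrow> x \<rightarrow>\<^sup>+\<^bsub>aux\<^esub> x \<Longrightarrow> size m = 1"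
  shows "CE2 G w"
  unfolding CE2_def
proof clarify
  fix C g
  assume C: "aux.cycle C" and g: "Bar g \<in> set C"
  then have "Bar g \<in> arcs aux"
    using aux.cycle_arcs by blast
  then obtain e where e: "g = Keep e" "e \<in> arcs G" "tail G e \<notin> Z" "w e > 1"
    by (auto simp: arcs_aux_iff)
  obtain f where f: "f \<in> set C" "aux_tail p1 f = tail G e"
    using aux.cycle_successor[OF C g] e(1) by auto
  then have "f \<in> arcs aux"
    using C aux.cycle_arcs by blast
  have "f \<noteq> Bar h" for h
  proof
    assume "f = Bar h"
    with \<open>f \<in> arcs aux\<close> obtain e' where "h = Keep e'" "e' \<in> weighted_arcs G w"
      by (auto simp: arcs_aux_iff weighted_arcs_iff)
    then show False
      using head_weighted_in_Z[of e'] f(2) e(3) \<open>f = Bar h\<close> by simp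
  qed
  then obtain d where d: "f = Plain d" "d \<in> arcs p1" "p1_weight w d = 1" "p1_tail G d \<notin> Z"
    using f(2) e(3) \<open>f \<in> arcs aux\<close> by (cases f) (auto simp: arcs_aux_iff)
  obtain e' where "d = Keep e'" "e' \<in> arcs G"
    using p1_tail_notin_Z[OF d(2,4)] .
  then have e': "f = Plain (Keep e')" "e' \<in> arcs G" "w e' = 1"
    using d by simp_all
  have "tail G e \<rightarrow>\<^sup>+\<^bsub>aux\<^esub> tail G e"
    using aux.cycle_imp_reachable1[OF C f(1)] f(2) by simp
  then have "e' = e"
    using rigid e(3) by (intro rigid_out_arcs[where x = "tail G e"]) (use e e' f in auto)
  then show False
    using e e' by simp
qed

text \<open>
  By (CE2) the closed walk gives a cycle of $E'$, and by (CE1) its edge at \<open>x\<close> is the only edge of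
  $E'$ starting there.  The size of the right-hand side of the rule of \<open>x\<close> is the number of edges of
  $E'$ starting at \<open>x\<close>.
\<close>

lemma CE_imp_rigid:
  assumes "CE1 G w" "CE2 G w" and rule: "(V x, m) \<in> vertex_rules" and x: "x \<rightarrow>\<^sup>+\<^bsub>aux\<^esub> x"
  shows "size m = 1"
proof -
  obtain C' where C': "cycle_at aux x C'"
    using aux.reachable1_imp_cycle_at[OF x] .
  have "Bar g \<notin> set C'" for g
    using \<open>CE2 G w\<close> C' unfolding CE2_def cycle_at_def by blast
  then have "d \<in> range Plain" if "d \<in> set C'" for d
    using that by (metis aux_edge.exhaust rangeI)
  then obtain C where C: "C' = map Plain C"
    by (metis ex_map_conv rangeE)
  then have cyc: "p1.cycle C"
    using C' by (simp add: cycle_at_def cycle_aux_map_Plain)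
  then have "C \<noteq> []"
    by (auto simp: p1.cycle_def)
  define c where "c = hd C"
  have c: "c \<in> set C" "p1_tail G c = x"
    using \<open>C \<noteq> []\<close> C' C by (auto simp: c_def cycle_at_def hd_map)
  then have arc: "c \<in> arcs p1"
    using cyc p1.cycle_arcs by blast
  have no_exit: "f = c" if "f \<in> arcs p1" "p1_tail G f = x" for f
  proof -
    have "tail p1 f \<in> tail p1 ` set C"
      using c that by (intro image_eqI[of _ _ c]) simp_all
    then have "f \<in> set C"
      using \<open>CE1 G w\<close> cyc that unfolding CE1_def is_exit_def by blast
    then show ?thesis
      using inj_onD[OF p1.cycle_inj_on_tail[OF cyc], of f c] c that by simp
  qed
  from rule consider "x \<in> verts G - Z" "plain_arcs x \<noteq> {}" "m = forward_rhs x"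
    | e where "e \<in> returned_arcs" "x = head G e" "m = backward_rhs e"
    by (auto simp: vertex_rules_def)
  then show ?thesis
  proof cases
    case 1
    have Keep: "Keep e = c" if "e \<in> out_arcs G x" for e
      using that 1(1) by (intro no_exit) (auto simp: arcs_p1_iff)
    obtain e where e: "e \<in> out_arcs G x"
      using 1(2) unfolding plain_arcs_def by blast
    have "e' = e" if "e' \<in> out_arcs G x" for e'
      using Keep[OF that] Keep[OF e] by (metis p1_edge.inject(2))
    with e have "out_arcs G x = {e}"
      by blast
    then show ?thesis
      using 1 by (simp add: size_forward_rhs)
  next
    case (2 e)
    then have "x \<in> Z"
      using head_returned_in_Z by simp
    then obtain e' i where e': "c = Split e' i" "e' \<in> returned_arcs" "tail G e' \<in> Z"
      using p1_tail_in_Z[OF arc] c(2) by metis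
    then have "e' = e"
      using inj_onD[OF inj_on_head_returned_arcs _ e'(2) 2(1)] c(2) 2(2) by simp
    then have e: "e \<in> arcs G" "tail G e \<in> Z"
      using e' returned_arcs_arcs by auto
    \<comment> \<open>The copies $e^{(1)}$ and $e^{(w(e))}$ are both equal to \<open>c\<close>, hence $w(e) = 1$.\<close>
    have "Split e j = c" if "1 \<le> j" "j \<le> w e" for j
      using that e 2(2) by (intro no_exit) (auto simp: arcs_p1_iff)
    from this[of 1] this[of "w e"] have "w e = 1"
      using weight_pos[OF e(1)] by (metis order.refl p1_edge.inject(1))
    then show ?thesis
      using 2(3) e(1) by (simp add: size_backward_rhs)
  qed
qed

end

theorem theorem4p16:
  fixes G :: "('a, 'b) pre_digraph" and w :: "'b \<Rightarrow> nat"
  assumes "lpa_weighted_graph G w"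
  shows "comm_monoid_cancel (weighted_graph_monoid G w) \<longleftrightarrow> CE1 G w \<and> CE2 G w"
proof -
  interpret lpa_weighted_graph G w by fact
  show ?thesis
    unfolding cancellative_iff_aux_rigid
    using rigid_imp_CE1 rigid_imp_CE2 CE_imp_rigid by blast
qed

end
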